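(* Let $q\ge 2$ be an integer, $\beta\ge 0$, and let $G=(V,E)$ be a finite graph. Let $P=P^{G}_{\beta,q}$ be the transition matrix of the Swendsen-Wang dynamics and $P_{\rm HB}=P^{G}_{{\rm HB},\beta,q}$ the transition matrix of the (single-site) heat-bath dynamics for the $q$-state Potts model on $G$ at inverse temperature $\beta$; both are reversible with respect to $\pi^{G}_{\beta,q}$. Let $\Delta:=\max_{v\in V}\deg_G(v)$. Then $$\lambda(P)\;\ge\; c_{\rm SW}\,\lambda(P_{\rm HB}),\qquad\text{where}\qquad c_{\rm SW}=c_{\rm SW}(G,\beta,q):=\frac{1}{2q^2}\left(q\,e^{2\beta}\right)^{-4\Delta}.$$
   Context: Graphs are finite, with nonempty vertex set $V$, $N:=|V|$, and edge set $E\subseteq\binom V2$ (simple, undirected). $\deg_G(v)$ is the degree of $v$. $[q]=\{1,\dots,q\}$ and $\Omega_{\rm P}=[q]^V$. Potts model: for $\sigma\in\Omega_{\rm P}$ put $E(\sigma):=\{\{u,v\}\in E:\sigma(u)=\sigma(v)\}$. The Boltzmann distribution is $\pi^{G}_{\beta,q}(\sigma)=\frac1Z\exp(\beta\,|E(\sigma)|)$, with $Z$ the normalizing constant. Heat-bath dynamics: for $\sigma\in\Omega_{\rm P}$, $v\in V$, $k\in[q]$ let $\sigma^{v,k}$ be the configuration with $\sigma^{v,k}(v)=k$ and $\sigma^{v,k}(u)=\sigma(u)$ for $u\ne v$. At each step a vertex $v$ is chosen uniformly at random and its color is resampled from $\pi^G_{\beta,q}$ conditioned on all other colors: $$P_{\rm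 HB}(\sigma,\tau)=\frac1N\sum_{v\in V}\sum_{k\in[q]}\frac{\pi^G_{\beta,q}(\sigma^{v,k})}{\sum_{l\in[q]}\pi^G_{\beta,q}(\sigma^{v,l})}\,\mathbf 1(\tau=\sigma^{v,k}).$$ Swendsen-Wang dynamics: with $p=1-e^{-\beta}$ and $C(A)$ the number of connected components of $(V,A)$ (isolated vertices counted), $$P(\sigma,\tau)=\sum_{A\subseteq E(\sigma)\cap E(\tau)}p^{|A|}(1-p)^{|E(\sigma)|-|A|}\,q^{-C(A)},\qquad \sigma,\tau\in\Omega_{\rm P}$$ (convention $0^0=1$). Spectral gap: for a transition matrix $K$ on a finite set $\Omega$ reversible with respect to a probability measure $\pi$, with (real) eigenvalues $1=\xi_0\ge\xi_1\ge\dots\ge\xi_{|\Omega|-1}\ge-1$, set $\lambda(K):=1-\max\{\xi_1,|\xi_{|\Omega|-1}|\}$. *)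

theory Defs
  imports
    "HOL-Library.FuncSet"
    "HOL-Library.Countable_Set"
    "Jordan_Normal_Form.Char_Poly"
begin

definition simple_graph :: "'a set \<Rightarrow> 'a set set \<Rightarrow> bool" where
  "simple_graph V E \<longleftrightarrow> finite V \<and> V \<noteq> {} \<and> E \<subseteq> {e. e \<subseteq> V \<and> card e = 2}"

definition degree_in :: "'a set set \<Rightarrow> 'a \<Rightarrow> nat" where
  "degree_in E v = card {e \<in> E. v \<in> e}"

definition max_degree :: "'a set \<Rightarrow> 'a set set \<Rightarrow> nat" where
  "max_degree V E = Max (degree_in E ` V)"

definition adjacency :: "'a set set \<Rightarrow> ('a \<times> 'a) set" where
  "adjacency A = {(u, v). {u, v} \<in> A}"

text \<open>The components are the classes of vertices under reachability; the reflexive closure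
  makes every isolated vertex a component of its own.\<close>

definition num_components :: "'a set \<Rightarrow> 'a set set \<Rightarrow> nat" where
  "num_components V A = card (V // (adjacency A)\<^sup>*)"

text \<open>Configurations are extensional functions, so that there are exactly \<open>q ^ card V\<close> of them.\<close>

definition configs :: "'a set \<Rightarrow> nat \<Rightarrow> ('a \<Rightarrow> nat) set" where
  "configs V q = V \<rightarrow>\<^sub>E {1..q}"

definition mono_edges :: "'a set set \<Rightarrow> ('a \<Rightarrow> nat) \<Rightarrow> 'a set set" where
  "mono_edges E \<sigma> = {{u, v} | u v. {u, v} \<in> E \<and> \<sigma> u = \<sigma> v}"

definition partition_fn :: "'a set \<Rightarrow> 'a set set \<Rightarrow> real \<Rightarrow> nat \<Rightarrow> real" where
  "partition_fn V E \<beta> q = (\<Sum>\<sigma>\<in>configs V q. exp (\<beta> * real (card (mono_edges E \<sigma>))))"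

definition potts :: "'a set \<Rightarrow> 'a set set \<Rightarrow> real \<Rightarrow> nat \<Rightarrow> ('a \<Rightarrow> nat) \<Rightarrow> real" where
  "potts V E \<beta> q \<sigma> = 1 / partition_fn V E \<beta> q * exp (\<beta> * real (card (mono_edges E \<sigma>)))"

definition heat_bath ::
  "'a set \<Rightarrow> 'a set set \<Rightarrow> real \<Rightarrow> nat \<Rightarrow> ('a \<Rightarrow> nat) \<Rightarrow> ('a \<Rightarrow> nat) \<Rightarrow> real" where
  "heat_bath V E \<beta> q \<sigma> \<tau> =
     1 / real (card V) *
       (\<Sum>v\<in>V. \<Sum>k\<in>{1..q}.
          potts V E \<beta> q (\<sigma>(v := k)) / (\<Sum>l\<in>{1..q}. potts V E \<beta> q (\<sigma>(v := l))) *
          of_bool (\<tau> = \<sigma>(v := k)))"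

definition swendsen_wang ::
  "'a set \<Rightarrow> 'a set set \<Rightarrow> real \<Rightarrow> nat \<Rightarrow> ('a \<Rightarrow> nat) \<Rightarrow> ('a \<Rightarrow> nat) \<Rightarrow> real" where
  "swendsen_wang V E \<beta> q \<sigma> \<tau> =
     (let p = 1 - exp (- \<beta>) in
        \<Sum>A\<in>Pow (mono_edges E \<sigma> \<inter> mono_edges E \<tau>).
          p ^ card A * (1 - p) ^ (card (mono_edges E \<sigma>) - card A) *
          real q powi (- int (num_components V A)))"

definition reversible_chain :: "'s set \<Rightarrow> ('s \<Rightarrow> real) \<Rightarrow> ('s \<Rightarrow> 's \<Rightarrow> real) \<Rightarrow> bool" where
  "reversible_chain \<Omega> \<pi> K \<longleftrightarrow>
     (\<forall>x\<in>\<Omega>. 0 \<le> \<pi> x) \<and> (\<Sum>x\<in>\<Omega>. \<pi> x) = 1 \<and>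
     (\<forall>x\<in>\<Omega>. \<forall>y\<in>\<Omega>. 0 \<le> K x y) \<and> (\<forall>x\<in>\<Omega>. (\<Sum>y\<in>\<Omega>. K x y) = 1) \<and>
     (\<forall>x\<in>\<Omega>. \<forall>y\<in>\<Omega>. \<pi> x * K x y = \<pi> y * K y x)"

text \<open>The kernel written as a matrix along the enumeration \<open>from_nat_into \<Omega>\<close> of the finite
  set \<open>\<Omega>\<close>; another enumeration gives a similar matrix, hence the same characteristic
  polynomial.\<close>

definition kernel_mat :: "'s set \<Rightarrow> ('s \<Rightarrow> 's \<Rightarrow> real) \<Rightarrow> real mat" where
  "kernel_mat \<Omega> K =
     mat (card \<Omega>) (card \<Omega>) (\<lambda>(i, j). K (from_nat_into \<Omega> i) (from_nat_into \<Omega> j))"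

text \<open>Real eigenvalues in decreasing order, repeated according to multiplicity as roots of the
  characteristic polynomial. For a kernel reversible with respect to a strictly positive measure
  that polynomial splits over the reals and the list has length \<open>card \<Omega>\<close>.\<close>

definition eigenvalue_list :: "'s set \<Rightarrow> ('s \<Rightarrow> 's \<Rightarrow> real) \<Rightarrow> real list" where
  "eigenvalue_list \<Omega> K = rev (sorted_list_of_multiset (proots (char_poly (kernel_mat \<Omega> K))))"

text \<open>Only meaningful for \<open>card \<Omega> \<ge> 2\<close>.\<close>

definition spectral_gap :: "'s set \<Rightarrow> ('s \<Rightarrow> 's \<Rightarrow> real) \<Rightarrow> real" where
  "spectral_gap \<Omega> K =
     1 - max (eigenvalue_list \<Omega> K ! 1) \<bar>eigenvalue_list \<Omega> K ! (card \<Omega> - 1)\<bar>"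

definition c_SW :: "'a set \<Rightarrow> 'a set set \<Rightarrow> real \<Rightarrow> nat \<Rightarrow> real" where
  "c_SW V E \<beta> q =
     1 / (2 * real q ^ 2) * (real q * exp (2 * \<beta>)) powi (- 4 * int (max_degree V E))"

end

theory Submission
  imports Defs "Jordan_Normal_Form.Schur_Decomposition"
begin

text \<open>
  Compare \<open>P\<close> with \<open>Q = H P H\<close>, where \<open>H\<close> is the heat-bath chain; \<open>P\<close> and \<open>H\<close> themselves are not
  directly comparable, since a single-site move is exponentially unlikely under \<open>P\<close>. The joint law
  of one step of \<open>P\<close> is \<open>\<pi>(\<sigma>) P(\<sigma>,\<tau>) = (1/Z) \<Sum> (e\<^sup>\<beta> - 1)^|A| q^(-C(A))\<close>, summed over the sets \<open>A\<close> of
  edges monochromatic in both \<open>\<sigma>\<close> and \<open>\<tau>\<close>. Hence it is positive semidefinite, and recolouring one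
  vertex in each of \<open>\<sigma>\<close> and \<open>\<tau>\<close> changes it by a factor of at most \<open>(q e\<^sup>\<beta>)^(2\<Delta>)\<close>, because at most
  \<open>2\<Delta>\<close> edges are affected and adding an edge to \<open>A\<close> lowers \<open>C(A)\<close> by at most one. Together with
  the change of \<open>\<pi>\<close> this gives \<open>\<pi> Q \<le> c \<pi> P\<close> pointwise with \<open>c = (q e^(2\<beta>))^(2\<Delta>)\<close>, and so
  \<open>1 - \<langle>f, Q f\<rangle> \<le> c (1 - \<langle>f, P f\<rangle>)\<close> for a unit eigenfunction \<open>f\<close> of \<open>P\<close> orthogonal to the constants.
  As \<open>P\<close> is a contraction, \<open>\<langle>f, Q f\<rangle> \<le> |H f|\<^sup>2 \<le> (1 - \<lambda>(H))\<^sup>2 \<le> 1 - \<lambda>(H)\<close>, whence \<open>\<lambda>(H) \<le> c \<lambda>(P)\<close>.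
\<close>

section \<open>Spectral theorem for real symmetric matrices\<close>

text \<open>The fundamental theorem of algebra provides a complex eigenvector; symmetry forces its
  eigenvalue to be real, so its real or its imaginary part, whichever is nonzero, is a real
  eigenvector.\<close>

lemma symmetric_real_eigenvector:
  fixes A :: "real mat"
  assumes A: "A \<in> carrier_mat n n" and sym: "transpose_mat A = A" and n: "n > 0"
  shows "\<exists>u e. u \<in> carrier_vec n \<and> u \<bullet> u = 1 \<and> A *\<^sub>v u = e \<cdot>\<^sub>v u"
proof -
  let ?C = "map_mat complex_of_real A"
  have C: "?C \<in> carrier_mat n n" using A by simp
  have "degree (char_poly ?C) = n" using degree_monic_char_poly[OF C] by simp
  with n have "\<not> constant (poly (char_poly ?C))" by (simp add: constant_degree)
  then obtain z where "poly (char_poly ?C) z = 0" using fundamental_theorem_of_algebra by blast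
  then have "eigenvalue ?C z" using eigenvalue_root_char_poly[OF C] by simp
  then obtain v where v: "v \<in> carrier_vec n" "v \<noteq> 0\<^sub>v n" "?C *\<^sub>v v = z \<cdot>\<^sub>v v"
    unfolding eigenvalue_def eigenvector_def using C by auto
  define a b where "a = map_vec Re v" and "b = map_vec Im v"
  define s t where "s = Re z" and "t = Im z"
  have ab: "a \<in> carrier_vec n" "b \<in> carrier_vec n" using v by (auto simp: a_def b_def)
  have comp: "(\<Sum>j<n. complex_of_real (A $$ (i,j)) * v $ j) = z * v $ i" if "i < n" for i
  proof -
    have "(\<Sum>j<n. complex_of_real (A $$ (i,j)) * v $ j) = (?C *\<^sub>v v) $ i"
      using that A v(1) by (simp add: scalar_prod_def lessThan_atLeast0)
    also have "\<dots> = z * v $ i" unfolding v(3) using that v(1) by simp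
    finally show ?thesis .
  qed
  have Aa: "A *\<^sub>v a = s \<cdot>\<^sub>v a - t \<cdot>\<^sub>v b"
  proof (rule eq_vecI)
    fix i assume "i < dim_vec (s \<cdot>\<^sub>v a - t \<cdot>\<^sub>v b)"
    then have i: "i < n" using ab by simp
    have "(A *\<^sub>v a) $ i = (\<Sum>j<n. A $$ (i,j) * Re (v $ j))"
      using A ab v i by (simp add: scalar_prod_def lessThan_atLeast0 a_def)
    also have "\<dots> = Re (\<Sum>j<n. complex_of_real (A $$ (i,j)) * v $ j)" by simp
    also have "\<dots> = s * Re (v $ i) - t * Im (v $ i)" unfolding comp[OF i] by (simp add: s_def t_def)
    finally show "(A *\<^sub>v a) $ i = (s \<cdot>\<^sub>v a - t \<cdot>\<^sub>v b) $ i" using i ab v by (simp add: a_def b_def)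
  qed (use A ab in auto)
  have Ab: "A *\<^sub>v b = t \<cdot>\<^sub>v a + s \<cdot>\<^sub>v b"
  proof (rule eq_vecI)
    fix i assume "i < dim_vec (t \<cdot>\<^sub>v a + s \<cdot>\<^sub>v b)"
    then have i: "i < n" using ab by simp
    have "(A *\<^sub>v b) $ i = (\<Sum>j<n. A $$ (i,j) * Im (v $ j))"
      using A ab v i by (simp add: scalar_prod_def lessThan_atLeast0 b_def)
    also have "\<dots> = Im (\<Sum>j<n. complex_of_real (A $$ (i,j)) * v $ j)" by simp
    also have "\<dots> = t * Re (v $ i) + s * Im (v $ i)" unfolding comp[OF i] by (simp add: s_def t_def)
    finally show "(A *\<^sub>v b) $ i = (t \<cdot>\<^sub>v a + s \<cdot>\<^sub>v b) $ i" using i ab v by (simp add: a_def b_def)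
  qed (use A ab in auto)
  have nz: "a \<noteq> 0\<^sub>v n \<or> b \<noteq> 0\<^sub>v n"
  proof (rule ccontr)
    assume "\<not> ?thesis"
    then have z: "a = 0\<^sub>v n" "b = 0\<^sub>v n" by auto
    have "v $ i = 0" if "i < n" for i
      using arg_cong[OF z(1), of "\<lambda>x. x $ i"] arg_cong[OF z(2), of "\<lambda>x. x $ i"] that v
      by (simp add: a_def b_def complex_eq_iff)
    then have "v = 0\<^sub>v n" using v by (intro eq_vecI) auto
    with v show False by simp
  qed
  have pos: "x \<bullet> x > 0" if "x \<in> carrier_vec n" "x \<noteq> 0\<^sub>v n" for x :: "real vec"
    using conjugate_square_greater_0_vec[OF that(1)] that by simp
  have nn: "x \<bullet> x \<ge> 0" for x :: "real vec"
    by (simp add: scalar_prod_def sum_nonneg)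
  \<comment> \<open>Expanding both sides by \<open>Aa\<close> and \<open>Ab\<close> leaves
    \<open>t\<close> times the squared norm of the complex vector, hence
    \<open>t = 0\<close>.\<close>
  have "(A *\<^sub>v a) \<bullet> b = a \<bullet> (A *\<^sub>v b)"
    using transpose_vec_mult_scalar[OF A ab(2) ab(1)] sym A ab
    by (metis comm_scalar_prod mult_mat_vec_carrier)
  then have "s * (a \<bullet> b) - t * (b \<bullet> b) = t * (a \<bullet> a) + s * (a \<bullet> b)"
    unfolding Aa Ab using ab by (simp add: minus_scalar_prod_distrib[of _ n] scalar_prod_add_distrib[of _ n])
  then have "t * (a \<bullet> a + b \<bullet> b) = 0" by (simp add: algebra_simps)
  moreover have "a \<bullet> a + b \<bullet> b > 0" using nz pos[OF ab(1)] pos[OF ab(2)] nn[of a] nn[of b] by fastforce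
  ultimately have t0: "t = 0" by simp
  have "\<exists>x\<in>carrier_vec n. x \<noteq> 0\<^sub>v n \<and> A *\<^sub>v x = s \<cdot>\<^sub>v x"
  proof (cases "a = 0\<^sub>v n")
    case False
    have "A *\<^sub>v a = s \<cdot>\<^sub>v a" unfolding Aa t0 using ab by (intro eq_vecI) auto
    then show ?thesis using False ab by blast
  next
    case True
    have "A *\<^sub>v b = s \<cdot>\<^sub>v b" unfolding Ab t0 using ab by (intro eq_vecI) auto
    then show ?thesis using True nz ab by blast
  qed
  then obtain x where x: "x \<in> carrier_vec n" "x \<noteq> 0\<^sub>v n" "A *\<^sub>v x = s \<cdot>\<^sub>v x" by blast
  define u where "u = (1 / sqrt (x \<bullet> x)) \<cdot>\<^sub>v x"
  have "u \<bullet> u = 1" using pos[OF x(1,2)] x(1) nn[of x]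
    by (simp add: u_def power2_eq_square[symmetric] field_simps)
  moreover have "A *\<^sub>v u = s \<cdot>\<^sub>v u" unfolding u_def using x A
    by (simp add: mult_mat_vec smult_smult_assoc mult.commute)
  ultimately show ?thesis using x(1) by (intro exI[of _ u]) (auto simp: u_def)
qed

text \<open>Gram-Schmidt applied to a basis that starts with \<open>u\<close> keeps \<open>u\<close>
  as its first vector, and normalising does not change it because \<open>u\<close> is already a unit
  vector.\<close>

lemma orthogonal_completion:
  fixes u :: "real vec"
  assumes u: "u \<in> carrier_vec n" and uu: "u \<bullet> u = 1" and n: "n > 0"
  shows "\<exists>W\<in>carrier_mat n n. transpose_mat W * W = 1\<^sub>m n \<and> col W 0 = u"
proof -
  interpret cof_vec_space n "TYPE(real)" .
  have u0: "u \<noteq> 0\<^sub>v n" using uu by auto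
  define ws where "ws = gram_schmidt n (basis_completion u)"
  note bc = basis_completion[OF u u0]
  have ws: "set ws \<subseteq> carrier_vec n" "corthogonal ws" "length ws = n"
    using gram_schmidt_result[OF bc(2,4,5) ws_def] bc(6) by auto
  have hd: "hd ws = u"
    unfolding ws_def using bc(6,7) n u by (cases "basis_completion u") auto
  define W where "W = mat_of_cols n (map (\<lambda>w. (1 / sqrt (w \<bullet> w)) \<cdot>\<^sub>v w) ws)"
  have W: "W \<in> carrier_mat n n" unfolding W_def using ws by auto
  have colW: "col W i = (1 / sqrt (ws ! i \<bullet> ws ! i)) \<cdot>\<^sub>v (ws ! i)" if "i < n" for i
    unfolding W_def using ws that by (subst col_mat_of_cols) auto
  have wsc: "ws ! i \<in> carrier_vec n" if "i < n" for i using ws that by auto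
  have "transpose_mat W * W = 1\<^sub>m n"
  proof (rule eq_matI)
    fix i j assume "i < dim_row (1\<^sub>m n :: real mat)" "j < dim_col (1\<^sub>m n :: real mat)"
    then have ij: "i < n" "j < n" by auto
    have "(transpose_mat W * W) $$ (i,j) = col W i \<bullet> col W j" using W ij by simp
    also have "\<dots> = (ws ! i \<bullet> ws ! j) / (sqrt (ws ! i \<bullet> ws ! i) * sqrt (ws ! j \<bullet> ws ! j))"
      using wsc[OF ij(1)] wsc[OF ij(2)] ij
      by (simp add: colW smult_scalar_prod_distrib[of _ n] scalar_prod_smult_distrib[of _ n])
    also have "\<dots> = (if i = j then 1 else 0)"
    proof (cases "i = j")
      case True
      have "ws ! i \<bullet> ws ! i \<noteq> 0" "ws ! i \<bullet> ws ! i \<ge> 0"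
        using corthogonalD[OF ws(2), of i i] ij ws by (auto simp: scalar_prod_def sum_nonneg)
      then show ?thesis using True by simp
    next
      case False
      then show ?thesis using corthogonalD[OF ws(2), of i j] ij ws by simp
    qed
    finally show "(transpose_mat W * W) $$ (i,j) = 1\<^sub>m n $$ (i,j)" using ij by simp
  qed (use W in auto)
  moreover have "ws ! 0 = u" using hd ws(3) n hd_conv_nth[of ws] by fastforce
  then have "col W 0 = u" using colW[of 0] n uu by simp
  ultimately show ?thesis using W by blast
qed

text \<open>Conjugation by an orthogonal \<open>W\<close> with first column \<open>u\<close> turns
  \<open>A\<close> into the direct sum of \<open>e\<close> and a smaller symmetric block, to which
  \<open>IH\<close> applies. The step is kept apart from the induction because the freedom to
  prescribe \<open>u\<close> is used again later.\<close>

lemma symmetric_spectral_step: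
  fixes A :: "real mat"
  assumes A: "A \<in> carrier_mat (Suc m) (Suc m)" and sym: "transpose_mat A = A"
    and u: "u \<in> carrier_vec (Suc m)" "u \<bullet> u = 1" and ev: "A *\<^sub>v u = e \<cdot>\<^sub>v u"
    and IH: "\<And>B :: real mat. B \<in> carrier_mat m m \<Longrightarrow> transpose_mat B = B \<Longrightarrow>
      \<exists>U\<in>carrier_mat m m. \<exists>d. transpose_mat U * U = 1\<^sub>m m \<and> B * U = U * mat_diag m d"
  shows "\<exists>U\<in>carrier_mat (Suc m) (Suc m). \<exists>d. transpose_mat U * U = 1\<^sub>m (Suc m) \<and>
    A * U = U * mat_diag (Suc m) d \<and> col U 0 = u \<and> d 0 = e"
proof -
  obtain W where W: "W \<in> carrier_mat (Suc m) (Suc m)"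
    and WW: "transpose_mat W * W = 1\<^sub>m (Suc m)" and W0: "col W 0 = u"
    using orthogonal_completion[OF u] by blast
  have WW': "W * transpose_mat W = 1\<^sub>m (Suc m)"
    using mat_mult_left_right_inverse[OF _ W WW] W by simp
  define B where "B = transpose_mat W * (A * W)"
  have B: "B \<in> carrier_mat (Suc m) (Suc m)" unfolding B_def using W A by auto
  have symB: "transpose_mat B = B"
  proof -
    have "transpose_mat B = transpose_mat (A * W) * W"
      unfolding B_def using W A by (subst transpose_mult[of _ "Suc m" "Suc m" _ "Suc m"]) auto
    also have "transpose_mat (A * W) = transpose_mat W * A"
      using W A sym by (subst transpose_mult[of _ "Suc m" "Suc m" _ "Suc m"]) auto
    also have "transpose_mat W * A * W = B"
      unfolding B_def using W A by (intro assoc_mult_mat) auto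
    finally show ?thesis .
  qed
  have AW: "A * W = W * B"
  proof -
    have "W * B = (W * transpose_mat W) * (A * W)"
      unfolding B_def using W A by (intro assoc_mult_mat[symmetric]) auto
    then show ?thesis unfolding WW' using A W by simp
  qed
  \<comment> \<open>The first column of \<open>W\<close> is the eigenvector \<open>u\<close>, so the
    first column of \<open>B\<close> is \<open>e\<close> times the first unit vector; symmetry of
    \<open>B\<close> then clears the rest of its first row.\<close>
  have col0: "B $$ (i,0) = (if i = 0 then e else 0)" if i: "i < Suc m" for i
  proof -
    have "B $$ (i,0) = col W i \<bullet> col (A * W) 0"
      unfolding B_def using i W A by auto
    also have "col (A * W) 0 = e \<cdot>\<^sub>v col W 0" using ev W0 by (simp add: col_mult2[OF A W] del: col_mult)
    also have "col W i \<bullet> (e \<cdot>\<^sub>v col W 0) = e * (transpose_mat W * W) $$ (i,0)"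
      using i W by simp
    also have "\<dots> = (if i = 0 then e else 0)" unfolding WW using i by simp
    finally show ?thesis .
  qed
  define B' where "B' = mat m m (\<lambda>(i,j). B $$ (Suc i, Suc j))"
  have B': "B' \<in> carrier_mat m m" unfolding B'_def by simp
  have Bij: "B $$ (i,j) = B $$ (j,i)" if "i < Suc m" "j < Suc m" for i j
    using arg_cong[OF symB, of "\<lambda>X. X $$ (j,i)"] that B by simp
  have symB': "transpose_mat B' = B'"
    unfolding B'_def using Bij by (intro eq_matI) auto
  have Bblock: "B = four_block_mat (mat 1 1 (\<lambda>_. e)) (0\<^sub>m 1 m) (0\<^sub>m m 1) B'" (is "_ = ?R")
  proof (rule eq_matI)
    fix i j assume "i < dim_row ?R" "j < dim_col ?R"
    then have ij: "i < Suc m" "j < Suc m" using B' by auto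
    then show "B $$ (i,j) = ?R $$ (i,j)"
      using B' col0[of i] col0[of j] Bij[of i j]
      by (cases i; cases j) (auto simp: B'_def)
  qed (use B B' in auto)
  obtain U' d' where U': "U' \<in> carrier_mat m m" and UU': "transpose_mat U' * U' = 1\<^sub>m m"
    and BU': "B' * U' = U' * mat_diag m d'" using IH[OF B' symB'] by blast
  \<comment> \<open>Acting as the identity on the first coordinate, \<open>F\<close> lets
    \<open>W * F\<close> keep \<open>u\<close> as its first column.\<close>
  define F where "F = four_block_mat (1\<^sub>m 1) (0\<^sub>m 1 m) (0\<^sub>m m 1) U'"
  define d where "d = case_nat e d'"
  have F: "F \<in> carrier_mat (Suc m) (Suc m)" unfolding F_def using U' by auto
  have D: "mat_diag (Suc m) d = four_block_mat (mat 1 1 (\<lambda>_. e)) (0\<^sub>m 1 m) (0\<^sub>m m 1) (mat_diag m d')"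
    (is "_ = ?R")
    by (rule eq_matI) (auto simp: mat_diag_def d_def split: nat.split)
  have md: "mat_diag m d' \<in> carrier_mat m m" by simp
  have BF: "B * F = F * mat_diag (Suc m) d"
    unfolding Bblock F_def D
    using B' U' BU' md by (subst (1 2) mult_four_block_mat[where ?nr1.0=1 and ?n1.0=1 and ?n2.0=m and ?nr2.0=m
          and ?nc1.0=1 and ?nc2.0=m]) (auto simp: left_mult_zero_mat[OF md])
  have tF: "transpose_mat F = four_block_mat (1\<^sub>m 1) (0\<^sub>m 1 m) (0\<^sub>m m 1) (transpose_mat U')"
    unfolding F_def using U'
    by (subst transpose_four_block_mat[where ?nr1.0=1 and ?nc1.0=1 and ?nr2.0=m and ?nc2.0=m]) auto
  have FF: "transpose_mat F * F = 1\<^sub>m (Suc m)"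
    unfolding tF unfolding F_def using U' UU'
    by (subst mult_four_block_mat[where ?nr1.0=1 and ?n1.0=1 and ?n2.0=m and ?nr2.0=m
          and ?nc1.0=1 and ?nc2.0=m]) (auto simp: four_block_one_mat)
  define U where "U = W * F"
  have U: "U \<in> carrier_mat (Suc m) (Suc m)" unfolding U_def using W F by auto
  have "transpose_mat U * U = transpose_mat F * (transpose_mat W * (W * F))"
    unfolding U_def using W F
    by (subst transpose_mult[of _ "Suc m" "Suc m" _ "Suc m"]) (auto intro!: assoc_mult_mat)
  also have "transpose_mat W * (W * F) = (transpose_mat W * W) * F"
    using W F by (intro assoc_mult_mat[symmetric]) auto
  finally have UU: "transpose_mat U * U = 1\<^sub>m (Suc m)" unfolding WW using F FF by simp
  have AU: "A * U = U * mat_diag (Suc m) d"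
  proof -
    have "A * U = (A * W) * F" unfolding U_def using A W F by (intro assoc_mult_mat[symmetric]) auto
    also have "\<dots> = W * (B * F)" unfolding AW using B W F by (intro assoc_mult_mat) auto
    also have "\<dots> = U * mat_diag (Suc m) d"
      unfolding BF U_def by (rule assoc_mult_mat[OF W F mat_diag_dim, symmetric])
    finally show ?thesis .
  qed
  have "col F 0 = unit_vec (Suc m) 0"
    unfolding F_def using U' by (intro eq_vecI) auto
  then have "col U 0 = W *\<^sub>v unit_vec (Suc m) 0" unfolding U_def by (simp add: col_mult2[OF W F] del: col_mult)
  then have U0: "col U 0 = u" using W W0 by (auto intro!: eq_vecI)
  show ?thesis using U UU AU U0 by (intro bexI[of _ U] exI[of _ d]) (auto simp: d_def)
qed

lemma symmetric_spectral:
  fixes A :: "real mat"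
  assumes "A \<in> carrier_mat n n" and "transpose_mat A = A"
  shows "\<exists>U\<in>carrier_mat n n. \<exists>d. transpose_mat U * U = 1\<^sub>m n \<and> A * U = U * mat_diag n d"
  using assms
proof (induction n arbitrary: A)
  case 0
  then show ?case by (intro bexI[of _ "1\<^sub>m 0"] exI[of _ "\<lambda>_. 0"]) (auto intro!: eq_matI simp: mat_diag_def)
next
  case (Suc m)
  obtain u e where "u \<in> carrier_vec (Suc m)" "u \<bullet> u = 1" "A *\<^sub>v u = e \<cdot>\<^sub>v u"
    using symmetric_real_eigenvector[OF Suc.prems] by blast
  from symmetric_spectral_step[OF Suc.prems this Suc.IH] show ?case by blast
qed

text \<open>With the induction hypothesis discharged, a unit eigenvector can be prescribed as the
  first column. Below it is \<open>sqrt \<pi>\<close>, which stands for the constant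
  function.\<close>

lemmas symmetric_spectral_with_eigenvector =
  symmetric_spectral_step[OF _ _ _ _ _ symmetric_spectral]

section \<open>Spectral gaps of reversible chains\<close>

lemma bij_betw_from_nat_into:
  assumes "finite \<Omega>"
  shows "bij_betw (from_nat_into \<Omega>) {..<card \<Omega>} \<Omega>"
  using bij_betw_from_nat_into_finite[OF assms] by (simp add: lessThan_atLeast0)

text \<open>The first clause is orthonormality in L^2 of \<open>\<pi>\<close>; the second is
  completeness, in the form from which Parseval's identity is read off. Index 0 is reserved for the
  constant function, so that a mean-zero function has no coefficient there.\<close>

definition eigenbasis ::
  "'s set \<Rightarrow> ('s \<Rightarrow> real) \<Rightarrow> ('s \<Rightarrow> 's \<Rightarrow> real) \<Rightarrow> (nat \<Rightarrow> 's \<Rightarrow> real) \<Rightarrow> (nat \<Rightarrow> real) \<Rightarrow> bool" where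
  "eigenbasis \<Omega> \<pi> K \<phi> d \<longleftrightarrow>
    (\<forall>i<card \<Omega>. \<forall>j<card \<Omega>. (\<Sum>x\<in>\<Omega>. \<pi> x * \<phi> i x * \<phi> j x) = of_bool (i = j)) \<and>
    (\<forall>x\<in>\<Omega>. \<forall>y\<in>\<Omega>. \<pi> x * (\<Sum>i<card \<Omega>. \<phi> i x * \<phi> i y) = of_bool (x = y)) \<and>
    (\<forall>i<card \<Omega>. \<forall>x\<in>\<Omega>. (\<Sum>y\<in>\<Omega>. K x y * \<phi> i y) = d i * \<phi> i x) \<and>
    (\<forall>x\<in>\<Omega>. \<phi> 0 x = 1) \<and> d 0 = 1"

text \<open>Detailed balance makes the matrix with entries
  \<open>sqrt (\<pi> x) * K x y / sqrt (\<pi> y)\<close> symmetric. Its orthonormal eigenvectors,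
  divided by \<open>sqrt \<pi>\<close>, are eigenfunctions of \<open>K\<close> that are orthonormal
  with respect to \<open>\<pi>\<close>; similarity identifies the numbers \<open>d\<close> with the
  roots of the characteristic polynomial, counted with multiplicity.\<close>

lemma reversible_eigenbasis:
  fixes \<Omega> :: "'s set"
  assumes fin: "finite \<Omega>" and ne: "\<Omega> \<noteq> {}"
    and rev: "reversible_chain \<Omega> \<pi> K" and pos: "\<And>x. x \<in> \<Omega> \<Longrightarrow> \<pi> x > 0"
  obtains \<phi> d where "eigenbasis \<Omega> \<pi> K \<phi> d"
    "proots (char_poly (kernel_mat \<Omega> K)) = mset (map d [0..<card \<Omega>])"
proof -
  define n where "n = card \<Omega>"
  have n: "n > 0" using fin ne by (auto simp: n_def card_gt_0_iff)
  then obtain m where m: "n = Suc m" by (cases n) auto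
  define e where "e = from_nat_into \<Omega>"
  have bij: "bij_betw e {..<n} \<Omega>" unfolding e_def n_def by (rule bij_betw_from_nat_into[OF fin])
  have e: "e i \<in> \<Omega>" if "i < n" for i using bij that by (auto simp: bij_betw_def)
  have reindex: "(\<Sum>x\<in>\<Omega>. g x) = (\<Sum>i<n. g (e i))" for g :: "'s \<Rightarrow> real"
    using sum.reindex_bij_betw[OF bij, of g] by simp
  define s where "s i = sqrt (\<pi> (e i))" for i
  have s: "s i > 0" "s i * s i = \<pi> (e i)" if "i < n" for i
    using pos[OF e[OF that]] by (auto simp: s_def)
  have K1: "(\<Sum>y\<in>\<Omega>. K x y) = 1" if "x \<in> \<Omega>" for x
    using rev that by (auto simp: reversible_chain_def)
  have db: "\<pi> x * K x y = \<pi> y * K y x" if "x \<in> \<Omega>" "y \<in> \<Omega>" for x y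
    using rev that by (auto simp: reversible_chain_def)
  define S where "S = mat n n (\<lambda>(i,j). s i * K (e i) (e j) / s j)"
  have S: "S \<in> carrier_mat n n" by (simp add: S_def)
  have symS: "transpose_mat S = S"
  proof (rule eq_matI)
    fix i j assume "i < dim_row S" "j < dim_col S"
    then have ij: "i < n" "j < n" using S by auto
    have "s i * s i * K (e i) (e j) = s j * s j * K (e j) (e i)"
      using db[of "e i" "e j"] e ij s by simp
    then have "s j * K (e j) (e i) / s i = s i * K (e i) (e j) / s j"
      using s(1)[OF ij(1)] s(1)[OF ij(2)] by (simp add: field_simps)
    then show "transpose_mat S $$ (i,j) = S $$ (i,j)" using ij by (simp add: S_def)
  qed (use S in auto)
  \<comment> \<open>This is \<open>sqrt \<pi>\<close>. It has norm one because \<open>\<pi>\<close>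
    is a probability measure and is fixed by \<open>S\<close> because the rows of \<open>K\<close>
    sum to one; divided by \<open>s\<close> it becomes the constant 1.\<close>
  define u where "u = vec n s"
  have u: "u \<in> carrier_vec n" by (simp add: u_def)
  have uu: "u \<bullet> u = 1"
  proof -
    have "u \<bullet> u = (\<Sum>i<n. \<pi> (e i))"
      using s(2) by (simp add: u_def scalar_prod_def lessThan_atLeast0)
    then show ?thesis using rev reindex[of \<pi>] by (simp add: reversible_chain_def)
  qed
  have Su: "S *\<^sub>v u = 1 \<cdot>\<^sub>v u"
  proof (rule eq_vecI)
    fix i assume "i < dim_vec (1 \<cdot>\<^sub>v u)"
    then have i: "i < n" using u by simp
    have "(S *\<^sub>v u) $ i = (\<Sum>j<n. s i * K (e i) (e j) / s j * s j)"
      using i S u by (simp add: S_def u_def scalar_prod_def lessThan_atLeast0)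
    also have "\<dots> = (\<Sum>j<n. s i * K (e i) (e j))"
      using s(1) by (intro sum.cong) fastforce+
    also have "\<dots> = s i" using K1[OF e[OF i]] reindex[of "K (e i)"]
      by (simp add: sum_distrib_left[symmetric])
    finally show "(S *\<^sub>v u) $ i = (1 \<cdot>\<^sub>v u) $ i" using i by (simp add: u_def)
  qed (use S u in auto)
  obtain U d where U: "U \<in> carrier_mat n n" and UU: "transpose_mat U * U = 1\<^sub>m n"
    and SU: "S * U = U * mat_diag n d" and U0: "col U 0 = u" and d0: "d 0 = 1"
    using symmetric_spectral_with_eigenvector[of S m u 1] S symS u uu Su unfolding m by blast
  have UU': "U * transpose_mat U = 1\<^sub>m n"
    using mat_mult_left_right_inverse[OF _ U UU] U by simp
  have orth1: "(\<Sum>k<n. U $$ (k,i) * U $$ (k,j)) = of_bool (i = j)" if "i < n" "j < n" for i j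
    using arg_cong[OF UU, of "\<lambda>X. X $$ (i,j)"] that U
    by (simp add: scalar_prod_def lessThan_atLeast0)
  have orth2: "(\<Sum>k<n. U $$ (i,k) * U $$ (j,k)) = of_bool (i = j)" if "i < n" "j < n" for i j
    using arg_cong[OF UU', of "\<lambda>X. X $$ (i,j)"] that U
    by (simp add: scalar_prod_def lessThan_atLeast0)
  have eig: "(\<Sum>k<n. S $$ (i,k) * U $$ (k,j)) = d j * U $$ (i,j)" if "i < n" "j < n" for i j
  proof -
    have "(S * U) $$ (i,j) = (U * mat_diag n d) $$ (i,j)" unfolding SU ..
    then show ?thesis using that U S
      by (simp add: mat_diag_mult_right[OF U] scalar_prod_def lessThan_atLeast0)
  qed
  define D where "D = mat_diag n s"
  define D' where "D' = mat_diag n (\<lambda>i. 1 / s i)"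
  define M where "M = kernel_mat \<Omega> K"
  have M: "M \<in> carrier_mat n n" by (simp add: M_def kernel_mat_def n_def)
  have DD: "D \<in> carrier_mat n n" "D' \<in> carrier_mat n n" by (auto simp: D_def D'_def)
  have inv: "D' * D = 1\<^sub>m n" "D * D' = 1\<^sub>m n"
    unfolding D_def D'_def mat_diag_diag using s(1)
    by (auto intro!: eq_matI simp: mat_diag_def less_imp_neq[THEN not_sym])
  have "S = D * M * D'"
    unfolding D_def D'_def mat_diag_mult_left[OF M]
    by (subst mat_diag_mult_right[of _ n]) (auto intro!: eq_matI simp: S_def M_def kernel_mat_def e_def n_def)
  then have "similar_mat S M" using S M DD inv by (intro similar_matI[of _ _ D D' n]) auto
  then have "char_poly M = char_poly S" by (simp add: char_poly_similar)
  also have "similar_mat S (mat_diag n d)"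
  proof (rule similar_matI[of _ _ U "transpose_mat U" n])
    have "S = S * (U * transpose_mat U)" unfolding UU' using S by simp
    also have "\<dots> = S * U * transpose_mat U" using S U by (intro assoc_mult_mat[symmetric]) auto
    finally show "S = U * mat_diag n d * transpose_mat U" unfolding SU .
  qed (use S U UU UU' in auto)
  then have "char_poly S = char_poly (mat_diag n d)" by (rule char_poly_similar)
  also have "\<dots> = (\<Prod>a\<leftarrow>diag_mat (mat_diag n d). [:- a, 1:])"
    by (rule char_poly_upper_triangular[of _ n]) (auto simp: mat_diag_def)
  also have "diag_mat (mat_diag n d) = map d [0..<n]"
    by (auto simp: diag_mat_def mat_diag_def)
  finally have cp: "char_poly M = (\<Prod>a\<leftarrow>map d [0..<n]. [:- a, 1:])" .
  have proots_lin: "proots (\<Prod>a\<leftarrow>xs. [:- a, 1:]) = mset xs" for xs :: "real list"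
  proof (induction xs)
    case (Cons x xs)
    have "(\<Prod>a\<leftarrow>xs. [:- a, 1:]) \<noteq> 0" by (auto simp: prod_list_zero_iff)
    then show ?case using Cons by (simp add: proots_mult del: mult_pCons_left)
  qed simp
  define ix where "ix = the_inv_into {..<n} e"
  have ix: "ix (e i) = i" if "i < n" for i
    using bij that by (auto simp: ix_def bij_betw_def the_inv_into_f_f)
  have ix2: "ix x < n" "e (ix x) = x" if "x \<in> \<Omega>" for x
    using bij that unfolding ix_def
    by (auto simp: bij_betw_def the_inv_into_f_f)
  define \<phi> where "\<phi> i x = U $$ (ix x, i) / s (ix x)" for i x
  show thesis
  proof (rule that[of \<phi> d], unfold eigenbasis_def n_def[symmetric], intro conjI allI ballI impI)
    fix i j assume ij: "i < n" "j < n"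
    have "(\<Sum>x\<in>\<Omega>. \<pi> x * \<phi> i x * \<phi> j x) = (\<Sum>k<n. U $$ (k,i) * U $$ (k,j))"
      unfolding reindex \<phi>_def
    proof (intro sum.cong refl)
      fix k assume "k \<in> {..<n}"
      then have k: "k < n" by simp
      show "\<pi> (e k) * (U $$ (ix (e k), i) / s (ix (e k))) * (U $$ (ix (e k), j) / s (ix (e k)))
        = U $$ (k,i) * U $$ (k,j)"
        unfolding s(2)[OF k, symmetric] using s(1)[OF k] by (simp add: ix[OF k])
    qed
    then show "(\<Sum>x\<in>\<Omega>. \<pi> x * \<phi> i x * \<phi> j x) = of_bool (i = j)" using orth1 ij by simp
  next
    fix x y assume xy: "x \<in> \<Omega>" "y \<in> \<Omega>"
    have "(\<Sum>i<n. \<phi> i x * \<phi> i y) = (\<Sum>i<n. U $$ (ix x,i) * U $$ (ix y,i)) / (s (ix x) * s (ix y))"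
      by (simp add: \<phi>_def sum_divide_distrib)
    also have "\<dots> = of_bool (ix x = ix y) / (s (ix x) * s (ix y))" using orth2 ix2 xy by simp
    finally have eq: "(\<Sum>i<n. \<phi> i x * \<phi> i y) = of_bool (ix x = ix y) / (s (ix x) * s (ix y))" .
    have "ix x = ix y \<longleftrightarrow> x = y" using ix2(2) xy by metis
    then show "\<pi> x * (\<Sum>i<n. \<phi> i x * \<phi> i y) = of_bool (x = y)"
      unfolding eq using s(2)[OF ix2(1)[OF xy(1)]] ix2(2)[OF xy(1)] pos[OF xy(1)] s(1)[OF ix2(1)[OF xy(1)]]
      by (cases "x = y") auto
  next
    fix i x assume i: "i < n" and x: "x \<in> \<Omega>"
    let ?k = "ix x"
    have k: "?k < n" "e ?k = x" using ix2 x by auto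
    have "(\<Sum>y\<in>\<Omega>. K x y * \<phi> i y) = (\<Sum>j<n. K x (e j) * U $$ (j,i) / s j)"
      unfolding reindex by (intro sum.cong) (auto simp: \<phi>_def ix)
    also have "\<dots> = (\<Sum>j<n. S $$ (?k,j) * U $$ (j,i)) / s ?k"
      unfolding sum_divide_distrib using s(1)[OF k(1)] k
      by (intro sum.cong) (auto simp: S_def)
    also have "\<dots> = d i * \<phi> i x" using eig[OF k(1) i] by (simp add: \<phi>_def)
    finally show "(\<Sum>y\<in>\<Omega>. K x y * \<phi> i y) = d i * \<phi> i x" .
  next
    fix x assume x: "x \<in> \<Omega>"
    have "U $$ (ix x, 0) = s (ix x)"
      using arg_cong[OF U0, of "\<lambda>v. v $ ix x"] ix2(1)[OF x] U n by (simp add: u_def)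
    then show "\<phi> 0 x = 1" using s(1)[OF ix2(1)[OF x]] by (simp add: \<phi>_def)
  next
    show "proots (char_poly (kernel_mat \<Omega> K)) = mset (map d [0..<n])"
      unfolding M_def[symmetric] cp by (rule proots_lin)
  qed (rule d0)
qed

text \<open>Lets the eigenvalue 1 of the constant function be taken as the head of the decreasing
  list, even if 1 is a multiple eigenvalue; the tail then consists of the eigenvalues with index at
  least 1.\<close>

lemma rev_sort_Cons_max:
  fixes a :: "'b :: linorder"
  assumes "\<And>x. x \<in> set xs \<Longrightarrow> x \<le> a"
  shows "rev (sort (a # xs)) = a # rev (sort xs)"
proof -
  have "sort xs @ [a] = sort (a # xs)"
    by (rule properties_for_sort[symmetric]) (use assms in \<open>auto simp: sorted_append\<close>)
  then show ?thesis by (metis rev.simps(2) rev_rev_ident rev_swap)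
qed

section \<open>Quadratic forms and extremal properties of the gap\<close>

lemma sum_swap_pairs:
  "(\<Sum>a\<in>A. \<Sum>b\<in>B. \<Sum>c\<in>C. \<Sum>d\<in>D. g a b c d) = (\<Sum>c\<in>C. \<Sum>d\<in>D. \<Sum>a\<in>A. \<Sum>b\<in>B. g a b c d)"
proof -
  have "(\<Sum>a\<in>A. \<Sum>b\<in>B. \<Sum>c\<in>C. \<Sum>d\<in>D. g a b c d) = (\<Sum>a\<in>A. \<Sum>c\<in>C. \<Sum>d\<in>D. \<Sum>b\<in>B. g a b c d)"
    by (intro sum.cong refl, subst sum.swap, intro sum.cong refl, rule sum.swap)
  also have "\<dots> = (\<Sum>c\<in>C. \<Sum>d\<in>D. \<Sum>a\<in>A. \<Sum>b\<in>B. g a b c d)"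
    by (subst sum.swap, intro sum.cong refl, rule sum.swap)
  finally show ?thesis .
qed

text \<open>Expand the square; by symmetry both marginals of \<open>w\<close> are
  \<open>\<pi>\<close>. The choice \<open>c = -1\<close> yields twice the Dirichlet form. The weight
  \<open>w\<close> is general because it will be the flow of a chain as well as a conjugated
  flow.\<close>

lemma symmetric_quadratic_form:
  fixes w :: "'s \<Rightarrow> 's \<Rightarrow> real"
  assumes sym: "\<And>x y. x \<in> \<Omega> \<Longrightarrow> y \<in> \<Omega> \<Longrightarrow> w x y = w y x"
    and row: "\<And>x. x \<in> \<Omega> \<Longrightarrow> (\<Sum>y\<in>\<Omega>. w x y) = \<pi> x"
  shows "(\<Sum>x\<in>\<Omega>. \<Sum>y\<in>\<Omega>. w x y * (f x + c * f y)\<^sup>2) =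
    (1 + c\<^sup>2) * (\<Sum>x\<in>\<Omega>. \<pi> x * (f x)\<^sup>2) + 2 * c * (\<Sum>x\<in>\<Omega>. \<Sum>y\<in>\<Omega>. w x y * f x * f y)"
proof -
  have 1: "(\<Sum>x\<in>\<Omega>. \<Sum>y\<in>\<Omega>. w x y * (f x)\<^sup>2) = (\<Sum>x\<in>\<Omega>. \<pi> x * (f x)\<^sup>2)"
    by (simp add: sum_distrib_right[symmetric] row)
  have "(\<Sum>x\<in>\<Omega>. \<Sum>y\<in>\<Omega>. w x y * (f y)\<^sup>2) = (\<Sum>y\<in>\<Omega>. \<Sum>x\<in>\<Omega>. w y x * (f y)\<^sup>2)"
    by (subst sum.swap) (use sym in \<open>auto intro!: sum.cong\<close>)
  then have 2: "(\<Sum>x\<in>\<Omega>. \<Sum>y\<in>\<Omega>. w x y * (f y)\<^sup>2) = (\<Sum>x\<in>\<Omega>. \<pi> x * (f x)\<^sup>2)" using 1 by simp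
  have 3: "w x y * (f x + c * f y)\<^sup>2 = w x y * (f x)\<^sup>2 + c\<^sup>2 * (w x y * (f y)\<^sup>2) + 2 * c * (w x y * f x * f y)" for x y
    by (simp add: power2_eq_square algebra_simps)
  show ?thesis
    unfolding 3 sum.distrib sum_distrib_left[symmetric] 1 2 by (simp add: distrib_right)
qed

text \<open>\<open>two_states\<close> ensures that entry 1 of the eigenvalue list, which
  \<open>spectral_gap\<close> reads, exists.\<close>

locale finite_reversible =
  fixes \<Omega> :: "'s set" and \<pi> :: "'s \<Rightarrow> real" and K :: "'s \<Rightarrow> 's \<Rightarrow> real"
  assumes finite_states: "finite \<Omega>" and two_states: "card \<Omega> \<ge> 2"
    and reversible: "reversible_chain \<Omega> \<pi> K" and pos: "x \<in> \<Omega> \<Longrightarrow> \<pi> x > 0"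
begin

lemma K_nonneg: "x \<in> \<Omega> \<Longrightarrow> y \<in> \<Omega> \<Longrightarrow> 0 \<le> K x y"
  and K_row: "x \<in> \<Omega> \<Longrightarrow> (\<Sum>y\<in>\<Omega>. K x y) = 1"
  and detailed_balance: "x \<in> \<Omega> \<Longrightarrow> y \<in> \<Omega> \<Longrightarrow> \<pi> x * K x y = \<pi> y * K y x"
  using reversible by (auto simp: reversible_chain_def)

lemma flow_row: "x \<in> \<Omega> \<Longrightarrow> (\<Sum>y\<in>\<Omega>. \<pi> x * K x y) = \<pi> x"
  by (simp add: sum_distrib_left[symmetric] K_row)

text \<open>The weighted sums of \<open>(f x + f y)\<^sup>2\<close> and of
  \<open>(f x - f y)\<^sup>2\<close> are nonnegative; one gives the lower bound, the other the upper
  bound.\<close>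

lemma abs_quadratic_form_le:
  "\<bar>\<Sum>x\<in>\<Omega>. \<Sum>y\<in>\<Omega>. \<pi> x * K x y * f x * f y\<bar> \<le> (\<Sum>x\<in>\<Omega>. \<pi> x * (f x)\<^sup>2)"
proof -
  have nn: "0 \<le> (\<Sum>x\<in>\<Omega>. \<Sum>y\<in>\<Omega>. \<pi> x * K x y * (f x + c * f y)\<^sup>2)" for c
    using K_nonneg pos by (intro sum_nonneg mult_nonneg_nonneg) (auto intro: less_imp_le)
  have q: "(\<Sum>x\<in>\<Omega>. \<Sum>y\<in>\<Omega>. \<pi> x * K x y * (f x + c * f y)\<^sup>2) =
    (1 + c\<^sup>2) * (\<Sum>x\<in>\<Omega>. \<pi> x * (f x)\<^sup>2) + 2 * c * (\<Sum>x\<in>\<Omega>. \<Sum>y\<in>\<Omega>. \<pi> x * K x y * f x * f y)" for c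
    by (rule symmetric_quadratic_form) (simp_all add: detailed_balance flow_row)
  show ?thesis using nn[of 1] nn[of "-1"] unfolding q by simp
qed

text \<open>Translates the list-based gap into an eigenbasis together with the indices of the
  largest and the smallest nontrivial eigenvalue; the facts about the gap below start from
  here.\<close>

lemma spectral_gap_data:
  obtains \<phi> d i\<^sub>1 i\<^sub>2 where "eigenbasis \<Omega> \<pi> K \<phi> d" "\<forall>i<card \<Omega>. \<bar>d i\<bar> \<le> 1"
    "i\<^sub>1 \<in> {1..<card \<Omega>}" "i\<^sub>2 \<in> {1..<card \<Omega>}"
    "\<forall>i\<in>{1..<card \<Omega>}. d i \<le> d i\<^sub>1 \<and> d i\<^sub>2 \<le> d i"
    "spectral_gap \<Omega> K = 1 - max (d i\<^sub>1) \<bar>d i\<^sub>2\<bar>"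
proof -
  define n where "n = card \<Omega>"
  have n: "n \<ge> 2" using two_states by (simp add: n_def)
  have ne: "\<Omega> \<noteq> {}" using two_states by auto
  obtain \<phi> d where basis: "eigenbasis \<Omega> \<pi> K \<phi> d"
    and roots: "proots (char_poly (kernel_mat \<Omega> K)) = mset (map d [0..<n])"
    by (rule reversible_eigenbasis[OF finite_states ne reversible pos, folded n_def])
  then have orth: "(\<Sum>x\<in>\<Omega>. \<pi> x * \<phi> i x * \<phi> j x) = of_bool (i = j)" if "i < n" "j < n" for i j
    using that by (simp add: eigenbasis_def n_def)
  have eig: "(\<Sum>y\<in>\<Omega>. K x y * \<phi> i y) = d i * \<phi> i x" if "i < n" "x \<in> \<Omega>" for i x
    using basis that by (simp add: eigenbasis_def n_def)
  have d0: "d 0 = 1" using basis by (simp add: eigenbasis_def)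
  \<comment> \<open>An eigenvalue is the value of the quadratic form at its unit
    eigenfunction.\<close>
  have d_le: "\<bar>d i\<bar> \<le> 1" if i: "i < n" for i
  proof -
    have "(\<Sum>x\<in>\<Omega>. \<Sum>y\<in>\<Omega>. \<pi> x * K x y * \<phi> i x * \<phi> i y) = (\<Sum>x\<in>\<Omega>. \<pi> x * \<phi> i x * (\<Sum>y\<in>\<Omega>. K x y * \<phi> i y))"
      by (simp add: sum_distrib_left mult_ac)
    also have "\<dots> = d i * (\<Sum>x\<in>\<Omega>. \<pi> x * \<phi> i x * \<phi> i x)"
      using eig[OF i] by (simp add: sum_distrib_left mult_ac)
    also have "\<dots> = d i" using orth[OF i i] by simp
    finally show ?thesis using abs_quadratic_form_le[of "\<phi> i"] orth[OF i i]
      by (simp add: power2_eq_square mult_ac)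
  qed
  define ys where "ys = map d [1..<n]"
  have ys: "ys \<noteq> []" "set ys = d ` {1..<n}" using n by (auto simp: ys_def)
  have "map d [0..<n] = 1 # ys" using n d0 by (simp add: ys_def upt_rec)
  moreover have "rev (sort (1 # ys)) = 1 # rev (sort ys)"
    by (rule rev_sort_Cons_max) (use d_le ys in force)
  ultimately have L: "eigenvalue_list \<Omega> K = 1 # rev (sort ys)"
    unfolding eigenvalue_list_def roots by simp
  have len: "length (sort ys) = n - 1" by (simp add: ys_def)
  define a b where "a = eigenvalue_list \<Omega> K ! 1" and "b = eigenvalue_list \<Omega> K ! (n - 1)"
  \<comment> \<open>The decreasing list is 1 followed by the reversal of the \<open>n - 1\<close>
    ascending entries of \<open>sort ys\<close>. Its entry 1 is therefore the last ascending one,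
    with index \<open>n - 2\<close>, and its entry \<open>n - 1\<close> is the first; for
    \<open>n = 2\<close> the two coincide.\<close>
  have ab: "a = sort ys ! (n - 2)" "b = sort ys ! 0"
    using n len unfolding a_def b_def L by (auto simp: rev_nth nth_Cons' numeral_2_eq_2)
  have "a \<in> set ys" "b \<in> set ys" using ab len n nth_mem[of _ "sort ys"] by auto
  then obtain i\<^sub>1 i\<^sub>2 where i: "i\<^sub>1 \<in> {1..<n}" "a = d i\<^sub>1" "i\<^sub>2 \<in> {1..<n}" "b = d i\<^sub>2" using ys by auto
  have ord: "d j \<le> a \<and> b \<le> d j" if "j \<in> {1..<n}" for j
  proof -
    have "d j \<in> set (sort ys)" using that ys by simp
    then obtain k where k: "k < n - 1" "sort ys ! k = d j" using len by (metis in_set_conv_nth)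
    then show ?thesis unfolding ab using n len
      by (auto intro!: sorted_nth_mono simp flip: k(2))
  qed
  show thesis
    by (rule that[of \<phi> d i\<^sub>1 i\<^sub>2])
      (use basis d_le i ord in \<open>auto simp: spectral_gap_def a_def b_def n_def\<close>)
qed

lemma spectral_gap_bounds: "0 \<le> spectral_gap \<Omega> K" "spectral_gap \<Omega> K \<le> 1"
proof -
  obtain d :: "nat \<Rightarrow> real" and i\<^sub>1 i\<^sub>2 where
    "\<forall>i<card \<Omega>. \<bar>d i\<bar> \<le> 1" "i\<^sub>1 \<in> {1..<card \<Omega>}" "i\<^sub>2 \<in> {1..<card \<Omega>}"
    "spectral_gap \<Omega> K = 1 - max (d i\<^sub>1) \<bar>d i\<^sub>2\<bar>"
    by (rule spectral_gap_data) blast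
  then show "0 \<le> spectral_gap \<Omega> K" "spectral_gap \<Omega> K \<le> 1"
    by (auto simp: abs_le_iff le_max_iff_disj)
qed

text \<open>In the eigenbasis \<open>K\<close> multiplies the \<open>i\<close>-th coefficient by
  \<open>d i\<close>. Mean zero removes the coefficient of the constant function, and every other
  \<open>d i\<close> has absolute value at most \<open>1 - spectral_gap \<Omega> K\<close>, which is
  where both ends of the spectrum enter.\<close>

lemma norm_contraction:
  assumes mean: "(\<Sum>x\<in>\<Omega>. \<pi> x * f x) = 0"
  shows "(\<Sum>x\<in>\<Omega>. \<pi> x * (\<Sum>y\<in>\<Omega>. K x y * f y)\<^sup>2) \<le> (1 - spectral_gap \<Omega> K)\<^sup>2 * (\<Sum>x\<in>\<Omega>. \<pi> x * (f x)\<^sup>2)"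
proof -
  obtain \<phi> d i\<^sub>1 i\<^sub>2 where basis: "eigenbasis \<Omega> \<pi> K \<phi> d"
    and ord: "\<forall>i\<in>{1..<card \<Omega>}. d i \<le> d i\<^sub>1 \<and> d i\<^sub>2 \<le> d i"
    and gap: "spectral_gap \<Omega> K = 1 - max (d i\<^sub>1) \<bar>d i\<^sub>2\<bar>"
    by (rule spectral_gap_data) blast
  have compl: "\<pi> x * (\<Sum>i<card \<Omega>. \<phi> i x * \<phi> i y) = of_bool (x = y)" if "x \<in> \<Omega>" "y \<in> \<Omega>" for x y
    using basis that by (simp add: eigenbasis_def)
  have eig: "(\<Sum>y\<in>\<Omega>. K x y * \<phi> i y) = d i * \<phi> i x" if "i < card \<Omega>" "x \<in> \<Omega>" for i x
    using basis that by (simp add: eigenbasis_def)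
  have \<phi>0: "\<phi> 0 x = 1" if "x \<in> \<Omega>" for x using basis that by (simp add: eigenbasis_def)
  define co where "co g i = (\<Sum>x\<in>\<Omega>. \<pi> x * g x * \<phi> i x)" for g :: "'s \<Rightarrow> real" and i
  define \<rho> where "\<rho> = 1 - spectral_gap \<Omega> K"
  \<comment> \<open>Completeness collapses the double sum over states to its diagonal, so
    \<open>g\<close> itself need not be expanded.\<close>
  have parseval: "(\<Sum>x\<in>\<Omega>. \<pi> x * (g x)\<^sup>2) = (\<Sum>i<card \<Omega>. (co g i)\<^sup>2)" for g
  proof -
    have "(\<Sum>i<card \<Omega>. (co g i)\<^sup>2)
      = (\<Sum>i<card \<Omega>. \<Sum>x\<in>\<Omega>. \<Sum>y\<in>\<Omega>. \<pi> x * g x * \<phi> i x * (\<pi> y * g y * \<phi> i y))"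
      by (simp add: co_def power2_eq_square sum_product)
    also have "\<dots> = (\<Sum>x\<in>\<Omega>. \<Sum>y\<in>\<Omega>. \<Sum>i<card \<Omega>. \<pi> x * g x * \<phi> i x * (\<pi> y * g y * \<phi> i y))"
      by (subst sum.swap, intro sum.cong refl, rule sum.swap)
    also have "\<dots> = (\<Sum>x\<in>\<Omega>. \<Sum>y\<in>\<Omega>. g x * \<pi> y * g y * (\<pi> x * (\<Sum>i<card \<Omega>. \<phi> i x * \<phi> i y)))"
      by (simp add: sum_distrib_left mult_ac)
    also have "\<dots> = (\<Sum>x\<in>\<Omega>. \<Sum>y\<in>\<Omega>. if x = y then g x * \<pi> y * g y else 0)"
      by (intro sum.cong refl) (simp add: compl)
    also have "\<dots> = (\<Sum>x\<in>\<Omega>. \<pi> x * (g x)\<^sup>2)"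
      using finite_states by (simp add: power2_eq_square mult_ac)
    finally show ?thesis ..
  qed
  \<comment> \<open>Detailed balance moves \<open>K\<close> from \<open>f\<close> onto the
    eigenfunction.\<close>
  have co_K: "co (\<lambda>x. \<Sum>y\<in>\<Omega>. K x y * f y) i = d i * co f i" if "i < card \<Omega>" for i
  proof -
    have "co (\<lambda>x. \<Sum>y\<in>\<Omega>. K x y * f y) i = (\<Sum>x\<in>\<Omega>. \<Sum>y\<in>\<Omega>. \<pi> x * K x y * f y * \<phi> i x)"
      by (simp add: co_def sum_distrib_left sum_distrib_right mult_ac)
    also have "\<dots> = (\<Sum>x\<in>\<Omega>. \<Sum>y\<in>\<Omega>. \<pi> y * K y x * f y * \<phi> i x)"
      by (intro sum.cong refl) (simp add: detailed_balance)
    also have "\<dots> = (\<Sum>y\<in>\<Omega>. \<pi> y * f y * (\<Sum>x\<in>\<Omega>. K y x * \<phi> i x))"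
      by (subst sum.swap) (simp add: sum_distrib_left mult_ac)
    also have "\<dots> = d i * co f i"
      using eig[OF that] by (simp add: co_def sum_distrib_left mult_ac)
    finally show ?thesis .
  qed
  have "co f 0 = 0" using mean \<phi>0 by (simp add: co_def)
  have "(d i * co f i)\<^sup>2 \<le> \<rho>\<^sup>2 * (co f i)\<^sup>2" if "i < card \<Omega>" for i
  proof (cases "i = 0")
    case True
    then show ?thesis using \<open>co f 0 = 0\<close> by simp
  next
    case False
    then have "d i \<le> d i\<^sub>1" "d i\<^sub>2 \<le> d i" using ord that by auto
    then have "\<bar>d i\<bar> \<le> \<rho>" unfolding \<rho>_def gap by linarith
    then have "(d i)\<^sup>2 \<le> \<rho>\<^sup>2" by (simp add: abs_le_square_iff[symmetric])
    then show ?thesis by (simp add: power_mult_distrib mult_right_mono)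
  qed
  then have "(\<Sum>i<card \<Omega>. (d i * co f i)\<^sup>2) \<le> (\<Sum>i<card \<Omega>. \<rho>\<^sup>2 * (co f i)\<^sup>2)"
    by (intro sum_mono) auto
  then show ?thesis unfolding parseval using co_K by (simp add: sum_distrib_left \<rho>_def)
qed

text \<open>Positive semidefiniteness makes the smallest eigenvalue nonnegative, so its absolute
  value cannot exceed the second largest eigenvalue, and an eigenfunction of the latter attains the
  gap.\<close>

lemma spectral_gap_attained:
  assumes psd: "\<And>f. 0 \<le> (\<Sum>x\<in>\<Omega>. \<Sum>y\<in>\<Omega>. \<pi> x * K x y * f x * f y)"
  obtains f where "(\<Sum>x\<in>\<Omega>. \<pi> x * f x) = 0" "(\<Sum>x\<in>\<Omega>. \<pi> x * (f x)\<^sup>2) = 1"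
    "(\<Sum>x\<in>\<Omega>. \<Sum>y\<in>\<Omega>. \<pi> x * K x y * f x * f y) = 1 - spectral_gap \<Omega> K"
proof -
  obtain \<phi> d i\<^sub>1 i\<^sub>2 where basis: "eigenbasis \<Omega> \<pi> K \<phi> d"
    and i: "i\<^sub>1 \<in> {1..<card \<Omega>}" "i\<^sub>2 \<in> {1..<card \<Omega>}"
    and ord: "\<forall>i\<in>{1..<card \<Omega>}. d i \<le> d i\<^sub>1 \<and> d i\<^sub>2 \<le> d i"
    and gap: "spectral_gap \<Omega> K = 1 - max (d i\<^sub>1) \<bar>d i\<^sub>2\<bar>"
    by (rule spectral_gap_data) blast
  have orth: "(\<Sum>x\<in>\<Omega>. \<pi> x * \<phi> i x * \<phi> j x) = of_bool (i = j)"
    if "i < card \<Omega>" "j < card \<Omega>" for i j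
    using basis that by (simp add: eigenbasis_def)
  have eig: "(\<Sum>y\<in>\<Omega>. K x y * \<phi> i y) = d i * \<phi> i x" if "i < card \<Omega>" "x \<in> \<Omega>" for i x
    using basis that by (simp add: eigenbasis_def)
  have \<phi>0: "\<phi> 0 x = 1" if "x \<in> \<Omega>" for x using basis that by (simp add: eigenbasis_def)
  have form: "(\<Sum>x\<in>\<Omega>. \<Sum>y\<in>\<Omega>. \<pi> x * K x y * \<phi> i x * \<phi> i y) = d i" if "i < card \<Omega>" for i
  proof -
    have "(\<Sum>x\<in>\<Omega>. \<Sum>y\<in>\<Omega>. \<pi> x * K x y * \<phi> i x * \<phi> i y) = (\<Sum>x\<in>\<Omega>. \<pi> x * \<phi> i x * (\<Sum>y\<in>\<Omega>. K x y * \<phi> i y))"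
      by (simp add: sum_distrib_left mult_ac)
    also have "\<dots> = d i * (\<Sum>x\<in>\<Omega>. \<pi> x * \<phi> i x * \<phi> i x)"
      using eig[OF that] by (simp add: sum_distrib_left mult_ac)
    finally show ?thesis using orth[OF that that] by simp
  qed
  have "0 \<le> d i\<^sub>2" using psd[of "\<phi> i\<^sub>2"] form i by simp
  then have gap': "spectral_gap \<Omega> K = 1 - d i\<^sub>1" using gap ord i by fastforce
  show thesis
  proof (rule that[of "\<phi> i\<^sub>1"])
    show "(\<Sum>x\<in>\<Omega>. \<pi> x * \<phi> i\<^sub>1 x) = 0" using orth[of 0 i\<^sub>1] i \<phi>0 by simp
    show "(\<Sum>x\<in>\<Omega>. \<pi> x * (\<phi> i\<^sub>1 x)\<^sup>2) = 1"
      using orth[of i\<^sub>1 i\<^sub>1] i by (simp add: power2_eq_square mult_ac)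
    show "(\<Sum>x\<in>\<Omega>. \<Sum>y\<in>\<Omega>. \<pi> x * K x y * \<phi> i\<^sub>1 x * \<phi> i\<^sub>1 y) = 1 - spectral_gap \<Omega> K"
      using form i gap' by simp
  qed
qed

end

text \<open>By detailed balance for \<open>H\<close>, the left side of \<open>le\<close> is
  \<open>\<pi> x\<close> times the \<open>(x, y)\<close> entry of the product \<open>H K H\<close>.
  This flow and that of \<open>K\<close> are both symmetric with marginal \<open>\<pi>\<close>, so
  pointwise domination passes to their Dirichlet forms, which are tested on the function attaining
  the gap of \<open>K\<close>.\<close>

lemma spectral_gap_comparison:
  assumes "finite_reversible \<Omega> \<pi> K" and "finite_reversible \<Omega> \<pi> H"
    and psd: "\<And>f. 0 \<le> (\<Sum>x\<in>\<Omega>. \<Sum>y\<in>\<Omega>. \<pi> x * K x y * f x * f y)"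
    and le: "\<And>x y. x \<in> \<Omega> \<Longrightarrow> y \<in> \<Omega> \<Longrightarrow>
      (\<Sum>x'\<in>\<Omega>. \<Sum>y'\<in>\<Omega>. \<pi> x' * K x' y' * H x' x * H y' y) \<le> c * (\<pi> x * K x y)"
  shows "spectral_gap \<Omega> H \<le> c * spectral_gap \<Omega> K"
proof -
  interpret K: finite_reversible \<Omega> \<pi> K by fact
  interpret H: finite_reversible \<Omega> \<pi> H by fact
  define M where "M x y = (\<Sum>x'\<in>\<Omega>. \<Sum>y'\<in>\<Omega>. \<pi> x' * K x' y' * H x' x * H y' y)" for x y
  obtain f where f: "(\<Sum>x\<in>\<Omega>. \<pi> x * f x) = 0" "(\<Sum>x\<in>\<Omega>. \<pi> x * (f x)\<^sup>2) = 1"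
    "(\<Sum>x\<in>\<Omega>. \<Sum>y\<in>\<Omega>. \<pi> x * K x y * f x * f y) = 1 - spectral_gap \<Omega> K"
    using K.spectral_gap_attained[OF psd] by blast
  define g where "g x = (\<Sum>y\<in>\<Omega>. H x y * f y)" for x
  have symM: "M x y = M y x" if "x \<in> \<Omega>" "y \<in> \<Omega>" for x y
    unfolding M_def by (subst sum.swap) (auto intro!: sum.cong simp: K.detailed_balance)
  \<comment> \<open>Summing out \<open>y\<close> and then \<open>y'\<close> uses the rows of
    \<open>H\<close> and of \<open>K\<close>; what remains is stationarity of \<open>\<pi>\<close>
    under \<open>H\<close>.\<close>
  have rowM: "(\<Sum>y\<in>\<Omega>. M x y) = \<pi> x" if x: "x \<in> \<Omega>" for x
  proof -
    have "(\<Sum>y\<in>\<Omega>. M x y) = (\<Sum>x'\<in>\<Omega>. \<Sum>y'\<in>\<Omega>. \<Sum>y\<in>\<Omega>. \<pi> x' * K x' y' * H x' x * H y' y)"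
      unfolding M_def by (subst sum.swap, rule sum.cong[OF refl], rule sum.swap)
    also have "\<dots> = (\<Sum>x'\<in>\<Omega>. \<Sum>y'\<in>\<Omega>. \<pi> x' * K x' y' * H x' x)"
      by (simp add: sum_distrib_left[symmetric] H.K_row)
    also have "\<dots> = (\<Sum>x'\<in>\<Omega>. \<pi> x' * H x' x)"
      by (simp add: sum_distrib_right[symmetric] K.flow_row)
    also have "\<dots> = (\<Sum>x'\<in>\<Omega>. \<pi> x * H x x')"
      using x by (intro sum.cong refl H.detailed_balance) auto
    finally show ?thesis using H.flow_row[OF x] by simp
  qed
  have "(\<Sum>x\<in>\<Omega>. \<Sum>y\<in>\<Omega>. M x y * f x * f y)
    = (\<Sum>x\<in>\<Omega>. \<Sum>y\<in>\<Omega>. \<Sum>x'\<in>\<Omega>. \<Sum>y'\<in>\<Omega>. \<pi> x' * K x' y' * ((H x' x * f x) * (H y' y * f y)))"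
    by (simp add: M_def sum_distrib_left sum_distrib_right mult_ac)
  also have "\<dots> = (\<Sum>x'\<in>\<Omega>. \<Sum>y'\<in>\<Omega>. \<Sum>x\<in>\<Omega>. \<Sum>y\<in>\<Omega>. \<pi> x' * K x' y' * ((H x' x * f x) * (H y' y * f y)))"
    by (rule sum_swap_pairs)
  also have "\<dots> = (\<Sum>x'\<in>\<Omega>. \<Sum>y'\<in>\<Omega>. \<pi> x' * K x' y' * (g x' * g y'))"
    unfolding g_def sum_product by (simp add: sum_distrib_left)
  also have "\<dots> \<le> (\<Sum>x\<in>\<Omega>. \<pi> x * (g x)\<^sup>2)"
    using K.abs_quadratic_form_le[of g] by (simp add: mult_ac)
  also have "\<dots> \<le> (1 - spectral_gap \<Omega> H)\<^sup>2"
    using H.norm_contraction[OF f(1)] f(2) by (simp add: g_def)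
  also have "\<dots> \<le> 1 - spectral_gap \<Omega> H"
    using H.spectral_gap_bounds by (simp add: power2_eq_square mult_left_le)
  \<comment> \<open>For \<open>c = -1\<close> and a unit \<open>f\<close> the expanded square is 2
    minus twice the quadratic form of \<open>M\<close>. The factor 2 cancels at the end against the
    same factor in the form of \<open>K\<close>.\<close>
  finally have "2 * spectral_gap \<Omega> H \<le> (\<Sum>x\<in>\<Omega>. \<Sum>y\<in>\<Omega>. M x y * (f x + - 1 * f y)\<^sup>2)"
    using symmetric_quadratic_form[of \<Omega> M \<pi> f "-1", OF symM rowM] f(2) by simp
  also have "\<dots> \<le> (\<Sum>x\<in>\<Omega>. \<Sum>y\<in>\<Omega>. c * (\<pi> x * K x y) * (f x + - 1 * f y)\<^sup>2)"
    using le unfolding M_def by (intro sum_mono mult_right_mono) auto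
  also have "\<dots> = c * (\<Sum>x\<in>\<Omega>. \<Sum>y\<in>\<Omega>. \<pi> x * K x y * (f x + - 1 * f y)\<^sup>2)"
    by (simp only: sum_distrib_left mult.assoc)
  also have "\<dots> = c * (2 * spectral_gap \<Omega> K)"
    using symmetric_quadratic_form[of \<Omega> "\<lambda>x y. \<pi> x * K x y" \<pi> f "-1",
        OF K.detailed_balance K.flow_row] f by simp
  finally show ?thesis by simp
qed

section \<open>Edge sets and their components\<close>

lemma sum_Pow_insert:
  assumes "finite T" "e \<notin> T"
  shows "(\<Sum>A\<in>Pow (insert e T). g A) = (\<Sum>A\<in>Pow T. g A + g (insert e A))"
proof -
  have "inj_on (insert e) (Pow T)" using assms(2) by (auto simp: inj_on_def)
  moreover have "Pow T \<inter> insert e ` Pow T = {}" using assms(2) by auto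
  ultimately show ?thesis
    using assms(1) by (simp add: Pow_insert sum.union_disjoint sum.reindex sum.distrib)
qed

lemma sum_Pow_binomial:
  assumes "finite T"
  shows "(\<Sum>A\<in>Pow T. p ^ card A * r ^ (card T - card A)) = (p + r :: real) ^ card T"
proof -
  have "(p + r) ^ card T = (\<Sum>A\<in>Pow T. (\<Prod>x\<in>A. p) * (\<Prod>x\<in>T - A. r))"
    using prod_add[OF assms, of "\<lambda>_. p" "\<lambda>_. r"] by simp
  also have "\<dots> = (\<Sum>A\<in>Pow T. p ^ card A * r ^ (card T - card A))"
    using assms by (intro sum.cong refl) (simp add: card_Diff_subset finite_subset)
  finally show ?thesis ..
qed

text \<open>Adjoin the elements of \<open>F\<close> one at a time: each new \<open>e\<close> pairs
  every \<open>A\<close> with \<open>insert e A\<close>, and such a pair weighs at most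
  \<open>(1 + y) * g A\<close>.\<close>

lemma sum_Pow_union_le:
  fixes g :: "'e set \<Rightarrow> real"
  assumes "finite T" "finite F" "y \<ge> 0"
    and nn: "\<And>A. A \<subseteq> T \<union> F \<Longrightarrow> 0 \<le> g A"
    and step: "\<And>e A. A \<subseteq> T \<union> F \<Longrightarrow> e \<in> F \<Longrightarrow> e \<notin> A \<Longrightarrow> g (insert e A) \<le> y * g A"
  shows "(\<Sum>A\<in>Pow (T \<union> F). g A) \<le> (1 + y) ^ card F * (\<Sum>A\<in>Pow T. g A)"
  using assms(2) nn step
proof (induction F)
  case (insert e F)
  have IH: "(\<Sum>A\<in>Pow (T \<union> F). g A) \<le> (1 + y) ^ card F * (\<Sum>A\<in>Pow T. g A)"
    by (rule insert.IH; rule insert.prems) auto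
  have nn: "0 \<le> (\<Sum>A\<in>Pow (T \<union> F). g A)" by (rule sum_nonneg, rule insert.prems) auto
  show ?case
  proof (cases "e \<in> T")
    \<comment> \<open>An element already in \<open>T\<close> leaves the index set unchanged, and the
      additional factor \<open>1 + y\<close> is at least 1.\<close>
    case True
    then have "T \<union> insert e F = T \<union> F" by auto
    moreover have "(1 + y) ^ card F * (\<Sum>A\<in>Pow T. g A) \<le> (1 + y) ^ card (insert e F) * (\<Sum>A\<in>Pow T. g A)"
      using insert.hyps assms(3) by (intro mult_right_mono sum_nonneg) (auto intro: insert.prems(1))
    ultimately show ?thesis using IH by simp
  next
    case False
    then have "(\<Sum>A\<in>Pow (T \<union> insert e F). g A) = (\<Sum>A\<in>Pow (T \<union> F). g A + g (insert e A))"
      using sum_Pow_insert[of "T \<union> F" e g] insert.hyps assms(1) by simp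
    also have "\<dots> \<le> (\<Sum>A\<in>Pow (T \<union> F). (1 + y) * g A)"
    proof (rule sum_mono)
      fix A assume "A \<in> Pow (T \<union> F)"
      then have "g (insert e A) \<le> y * g A" using False insert.hyps by (intro insert.prems(2)) auto
      then show "g A + g (insert e A) \<le> (1 + y) * g A" by (simp add: algebra_simps)
    qed
    also have "\<dots> = (1 + y) * (\<Sum>A\<in>Pow (T \<union> F). g A)" by (simp add: sum_distrib_left)
    also have "\<dots> \<le> (1 + y) * ((1 + y) ^ card F * (\<Sum>A\<in>Pow T. g A))"
      using IH assms(3) by (intro mult_left_mono) auto
    finally show ?thesis using insert.hyps by (simp add: mult.assoc)
  qed
qed simp

section \<open>Monochromatic edges and connected components\<close>

lemma mono_edges_iff:
  assumes "{u, v} \<in> E"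
  shows "{u, v} \<in> mono_edges E \<sigma> \<longleftrightarrow> \<sigma> u = \<sigma> v"
  using assms unfolding mono_edges_def by (auto simp: doubleton_eq_iff)

lemma mono_edges_subset: "mono_edges E \<sigma> \<subseteq> E"
  unfolding mono_edges_def by auto

abbreviation connected_by :: "'a set set \<Rightarrow> ('a \<times> 'a) set" where
  "connected_by A \<equiv> (adjacency A)\<^sup>*"

lemma equiv_connected_by: "equiv UNIV (connected_by A)"
proof (rule equivI)
  have "sym (adjacency A)" by (auto simp: sym_def adjacency_def insert_commute)
  then show "sym (connected_by A)" by (rule sym_rtrancl)
qed (auto simp: refl_on_def trans_rtrancl)

lemma connected_by_class_eq: "connected_by A `` {x} = connected_by A `` {y} \<longleftrightarrow> (x, y) \<in> connected_by A"
  using eq_equiv_class_iff[OF equiv_connected_by, of x y A] by simp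

text \<open>A path joining two old components must cross the new edge, so one of its ends lies in
  the old component of \<open>u\<close>. Hence classes other than that of \<open>u\<close> are not
  merged with one another.\<close>

lemma connected_by_insert:
  assumes "(x, y) \<in> connected_by (insert {u, v} A)" and "(x, y) \<notin> connected_by A"
  shows "(x, u) \<in> connected_by A \<or> (y, u) \<in> connected_by A"
proof -
  have sym: "(b, a) \<in> connected_by A" if "(a, b) \<in> connected_by A" for a b
    using equiv_connected_by[of A] that unfolding equiv_def sym_def by blast
  have ins: "adjacency (insert {u, v} A) = insert (u, v) (insert (v, u) (adjacency A))"
    by (auto simp: adjacency_def doubleton_eq_iff)
  have "(x, y) \<in> connected_by A \<or> (x, u) \<in> connected_by A \<or> (u, y) \<in> connected_by A \<or>
    (x, v) \<in> connected_by A \<and> (v, y) \<in> connected_by A"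
    using assms(1) unfolding ins rtrancl_insert by blast
  then show ?thesis using assms(2) sym rtrancl_trans[of x v "adjacency A" y] by blast
qed

text \<open>Map each old class to the new class containing it. Every merger involves the class of
  \<open>u\<close>, so the map is injective once that class is removed, and the count falls by at
  most one.\<close>

lemma num_components_insert:
  assumes fin: "finite V" and u: "u \<in> V"
  shows "num_components V A \<le> Suc (num_components V (insert {u, v} A))"
proof -
  let ?R = "connected_by A" and ?R' = "connected_by (insert {u, v} A)"
  have sub: "?R \<subseteq> ?R'" by (rule rtrancl_mono) (auto simp: adjacency_def)
  have cls: "?R' `` (?R `` {x}) = ?R' `` {x}" for x
  proof (intro equalityI subsetI)
    fix y assume "y \<in> ?R' `` (?R `` {x})"
    then obtain z where "(x, z) \<in> ?R" "(z, y) \<in> ?R'" by blast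
    then have "(x, y) \<in> ?R'" using sub rtrancl_trans[of x z _ y] by blast
    then show "y \<in> ?R' `` {x}" by simp
  qed blast
  define Q where "Q = V // ?R - {?R `` {u}}"
  have finQ: "finite (V // ?R)"
    using fin by (auto simp: quotient_def)
  have fin': "finite (V // ?R')" using fin by (auto simp: quotient_def)
  have "inj_on (\<lambda>X. ?R' `` X) Q"
  proof (rule inj_onI)
    fix X Y assume X: "X \<in> Q" and Y: "Y \<in> Q" and eq: "?R' `` X = ?R' `` Y"
    obtain x y where xy: "X = ?R `` {x}" "Y = ?R `` {y}" using X Y by (auto simp: Q_def quotient_def)
    have xy': "(x, y) \<in> ?R'" using eq unfolding xy cls connected_by_class_eq .
    have "(x, u) \<notin> ?R" "(y, u) \<notin> ?R"
      using X Y unfolding Q_def xy by (auto simp: connected_by_class_eq)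
    with connected_by_insert[OF xy'] show "X = Y"
      unfolding xy connected_by_class_eq by (cases "(x, y) \<in> ?R") simp_all
  qed
  moreover have "(\<lambda>X. ?R' `` X) ` Q \<subseteq> V // ?R'"
    by (auto simp: Q_def quotient_def cls)
  ultimately have "card Q \<le> card (V // ?R')" using fin' by (rule card_inj_on_le)
  moreover have "?R `` {u} \<in> V // ?R" using u by (rule quotientI)
  then have "card (V // ?R) = Suc (card Q)" unfolding Q_def by (rule card.remove[OF finQ])
  ultimately show ?thesis by (simp add: num_components_def)
qed

text \<open>Such colourings are constant along paths in \<open>A\<close>, so they amount to
  colourings of the components: compose with the class map in one direction, evaluate at
  representatives in the other. The count cancels the factor q^(-C(A)) in the row sums of the
  Swendsen-Wang kernel.\<close>

lemma card_constant_on_components: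
  assumes fin: "finite V" and E: "E \<subseteq> {e. e \<subseteq> V \<and> card e = 2}" and A: "A \<subseteq> E"
  shows "card {\<tau> \<in> configs V q. A \<subseteq> mono_edges E \<tau>} = q ^ num_components V A"
proof -
  let ?R = "connected_by A"
  have const: "\<tau> x = \<tau> y" if "A \<subseteq> mono_edges E \<tau>" "(x, y) \<in> ?R" for \<tau> :: "'a \<Rightarrow> nat" and x y
    using that(2)
  proof (induction rule: rtrancl_induct)
    case (step y z)
    then have yz: "{y, z} \<in> A" by (simp add: adjacency_def)
    then have "\<tau> y = \<tau> z" using mono_edges_iff[of y z E \<tau>] that(1) A by blast
    then show ?case using step by simp
  qed simp
  let ?F = "\<lambda>\<phi>. \<lambda>x\<in>V. \<phi> (?R `` {x})"
  \<comment> \<open>The representative is taken inside \<open>V\<close>, where configurations have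
    values in \<open>{1..q}\<close>; which one is chosen does not matter, as the colourings
    considered are constant on classes.\<close>
  define rep where "rep X = (SOME x. x \<in> X \<and> x \<in> V)" for X
  let ?G = "\<lambda>\<tau>. \<lambda>X\<in>V // ?R. \<tau> (rep X)"
  have rep: "(x, rep (?R `` {x})) \<in> ?R" "rep (?R `` {x}) \<in> V" if "x \<in> V" for x
    using someI[of "\<lambda>z. z \<in> ?R `` {x} \<and> z \<in> V" x] that unfolding rep_def by auto
  have "bij_betw ?F ((V // ?R) \<rightarrow>\<^sub>E {1..q}) {\<tau> \<in> configs V q. A \<subseteq> mono_edges E \<tau>}"
  proof (rule bij_betw_byWitness[where f' = ?G])
    show "\<forall>\<phi>\<in>(V // ?R) \<rightarrow>\<^sub>E {1..q}. ?G (?F \<phi>) = \<phi>"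
    proof
      fix \<phi> assume \<phi>: "\<phi> \<in> (V // ?R) \<rightarrow>\<^sub>E {1..q}"
      show "?G (?F \<phi>) = \<phi>"
      proof
        fix X
        show "?G (?F \<phi>) X = \<phi> X"
        proof (cases "X \<in> V // ?R")
          case True
          then obtain x where x: "x \<in> V" "X = ?R `` {x}" by (auto simp: quotient_def)
          have "?R `` {x} = ?R `` {rep X}"
            unfolding connected_by_class_eq using rep(1)[OF x(1)] x(2) by simp
          then show ?thesis using rep(2)[OF x(1)] True x(2) by simp
        next
          case False
          then show ?thesis using \<phi> by (auto simp: PiE_def extensional_def)
        qed
      qed
    qed
    show "\<forall>\<tau>\<in>{\<tau> \<in> configs V q. A \<subseteq> mono_edges E \<tau>}. ?F (?G \<tau>) = \<tau>"
    proof
      fix \<tau> assume \<tau>: "\<tau> \<in> {\<tau> \<in> configs V q. A \<subseteq> mono_edges E \<tau>}"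
      show "?F (?G \<tau>) = \<tau>"
      proof
        fix x
        show "?F (?G \<tau>) x = \<tau> x"
        proof (cases "x \<in> V")
          case True
          then show ?thesis using rep[OF True] const[of \<tau> x] \<tau> by (simp add: quotientI)
        next
          case False
          then show ?thesis using \<tau> by (auto simp: configs_def PiE_def extensional_def)
        qed
      qed
    qed
    show "?F ` ((V // ?R) \<rightarrow>\<^sub>E {1..q}) \<subseteq> {\<tau> \<in> configs V q. A \<subseteq> mono_edges E \<tau>}"
    proof
      fix \<tau> assume "\<tau> \<in> ?F ` ((V // ?R) \<rightarrow>\<^sub>E {1..q})"
      then obtain \<phi> where \<phi>: "\<phi> \<in> (V // ?R) \<rightarrow>\<^sub>E {1..q}" and \<tau>: "\<tau> = ?F \<phi>" by blast
      have "\<phi> (?R `` {x}) \<in> {1..q}" if "x \<in> V" for x using PiE_mem[OF \<phi> quotientI[OF that]] .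
      then have "\<tau> \<in> configs V q" unfolding configs_def \<tau> by auto
      moreover have "e \<in> mono_edges E \<tau>" if "e \<in> A" for e
      proof -
        have e: "e \<in> E" "e \<subseteq> V" "card e = 2" using that A E by auto
        then obtain u v where uv: "e = {u, v}" by (auto simp: card_2_iff)
        then have "(u, v) \<in> ?R" using that by (auto simp: adjacency_def)
        then have "?R `` {u} = ?R `` {v}" by (simp add: connected_by_class_eq)
        then show ?thesis using e uv mono_edges_iff[of u v E \<tau>] by (simp add: \<tau>)
      qed
      ultimately show "\<tau> \<in> {\<tau> \<in> configs V q. A \<subseteq> mono_edges E \<tau>}" by blast
    qed
    show "?G ` {\<tau> \<in> configs V q. A \<subseteq> mono_edges E \<tau>} \<subseteq> (V // ?R) \<rightarrow>\<^sub>E {1..q}"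
    proof
      fix \<phi> assume "\<phi> \<in> ?G ` {\<tau> \<in> configs V q. A \<subseteq> mono_edges E \<tau>}"
      then obtain \<tau> where \<tau>: "\<tau> \<in> configs V q" and \<phi>: "\<phi> = ?G \<tau>" by blast
      have "\<tau> (rep X) \<in> {1..q}" if X: "X \<in> V // ?R" for X
      proof -
        obtain x where x: "x \<in> V" "X = ?R `` {x}" using X by (auto simp: quotient_def)
        show ?thesis using \<tau> rep(2)[OF x(1)] unfolding configs_def x(2) by (rule PiE_mem)
      qed
      then show "\<phi> \<in> (V // ?R) \<rightarrow>\<^sub>E {1..q}" unfolding \<phi> by auto
    qed
  qed
  then have "card {\<tau> \<in> configs V q. A \<subseteq> mono_edges E \<tau>} = card ((V // ?R) \<rightarrow>\<^sub>E {1..q})"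
    by (simp add: bij_betw_same_card)
  moreover have "finite (V // ?R)" using fin by (auto simp: quotient_def)
  ultimately show ?thesis by (simp add: card_PiE num_components_def)
qed

section \<open>The Potts model\<close>

locale potts_model =
  fixes V :: "'a set" and E :: "'a set set" and q :: nat and \<beta> :: real
  assumes graph: "simple_graph V E" and q: "q \<ge> 2" and \<beta>: "\<beta> \<ge> 0"
begin

abbreviation \<Omega> where "\<Omega> \<equiv> configs V q"
abbreviation \<pi> where "\<pi> \<equiv> potts V E \<beta> q"
abbreviation Z where "Z \<equiv> partition_fn V E \<beta> q"
abbreviation SW where "SW \<equiv> swendsen_wang V E \<beta> q"
abbreviation HB where "HB \<equiv> heat_bath V E \<beta> q"
abbreviation mono where "mono \<equiv> mono_edges E"
abbreviation \<Delta> where "\<Delta> \<equiv> max_degree V E"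

lemma finite_V: "finite V" and V_nonempty: "V \<noteq> {}" and edges: "E \<subseteq> {e. e \<subseteq> V \<and> card e = 2}"
  using graph by (auto simp: simple_graph_def)

lemma finite_E: "finite E"
  using edges finite_V by (auto intro: finite_subset[of _ "Pow V"])

lemma finite_mono: "finite (mono \<sigma>)"
  using finite_E mono_edges_subset by (rule finite_subset[rotated])

lemma finite_configs: "finite \<Omega>"
  unfolding configs_def using finite_V by (intro finite_PiE) auto

lemma card_configs: "card \<Omega> \<ge> 2"
proof -
  have "q ^ 1 \<le> q ^ card V"
    using q finite_V V_nonempty by (intro power_increasing) (auto simp: Suc_le_eq card_gt_0_iff)
  then show ?thesis using q finite_V by (simp add: configs_def card_funcsetE)
qed

lemma fun_upd_configs: "\<sigma> \<in> \<Omega> \<Longrightarrow> v \<in> V \<Longrightarrow> k \<in> {1..q} \<Longrightarrow> \<sigma>(v := k) \<in> \<Omega>"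
  unfolding configs_def by (auto simp: PiE_def extensional_def Pi_def)

lemma color: "\<sigma> \<in> \<Omega> \<Longrightarrow> v \<in> V \<Longrightarrow> \<sigma> v \<in> {1..q}"
  unfolding configs_def by (rule PiE_mem)

lemma Z_pos: "Z > 0"
  unfolding partition_fn_def using finite_configs card_configs by (intro sum_pos) auto

lemma potts_pos: "\<pi> \<sigma> > 0"
  using Z_pos by (simp add: potts_def)

lemma potts_nonneg: "0 \<le> \<pi> \<sigma>"
  using potts_pos by (rule less_imp_le)

lemma sum_potts: "(\<Sum>\<sigma>\<in>\<Omega>. \<pi> \<sigma>) = 1"
proof -
  have "(\<Sum>\<sigma>\<in>\<Omega>. \<pi> \<sigma>) = 1 / Z * (\<Sum>\<sigma>\<in>\<Omega>. exp (\<beta> * real (card (mono \<sigma>))))"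
    by (simp only: potts_def sum_distrib_left)
  also have "\<dots> = 1 / Z * Z" by (simp only: partition_fn_def)
  finally have "(\<Sum>\<sigma>\<in>\<Omega>. \<pi> \<sigma>) = 1 / Z * Z" .
  then show ?thesis using Z_pos by simp
qed

section \<open>The Swendsen-Wang chain\<close>

text \<open>The Fortuin-Kasteleyn weight \<open>(e\<^sup>\<beta> - 1)^|A| q^C(A)\<close> divided by \<open>q^(2 C(A))\<close>, the number of
  pairs of colourings compatible with \<open>A\<close>.\<close>

definition cluster_weight :: "'a set set \<Rightarrow> real" where
  "cluster_weight A = (exp \<beta> - 1) ^ card A / real q ^ num_components V A"

lemma cluster_weight_nonneg: "0 \<le> cluster_weight A"
  using \<beta> by (simp add: cluster_weight_def)

text \<open>Each edge of \<open>A\<close> contributes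
  \<open>exp \<beta> * (1 - exp (- \<beta>)) = exp \<beta> - 1\<close>, and each other monochromatic
  edge of \<open>\<sigma>\<close> contributes \<open>exp \<beta> * exp (- \<beta>) = 1\<close>. The
  resulting expression is symmetric in \<open>\<sigma>\<close> and \<open>\<tau>\<close>, which is
  detailed balance.\<close>

lemma potts_swendsen_wang:
  "\<pi> \<sigma> * SW \<sigma> \<tau> = (\<Sum>A\<in>Pow (mono \<sigma> \<inter> mono \<tau>). cluster_weight A) / Z"
proof -
  have "exp (\<beta> * real (card (mono \<sigma>))) *
      ((1 - exp (- \<beta>)) ^ card A * (1 - (1 - exp (- \<beta>))) ^ (card (mono \<sigma>) - card A) *
        real q powi (- int (num_components V A))) = cluster_weight A"
    if A: "A \<in> Pow (mono \<sigma> \<inter> mono \<tau>)" for A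
  proof -
    have "card A \<le> card (mono \<sigma>)" using A finite_mono by (intro card_mono) auto
    then obtain k where k: "card (mono \<sigma>) = card A + k" using le_Suc_ex by blast
    have "exp (\<beta> * real (card (mono \<sigma>))) = exp \<beta> ^ card A * exp \<beta> ^ k"
      unfolding k by (simp add: exp_of_nat2_mult[symmetric] exp_add[symmetric] distrib_left mult.commute)
    moreover have "exp \<beta> ^ k * exp (- \<beta>) ^ k = 1"
      by (simp add: power_mult_distrib[symmetric] exp_add[symmetric])
    moreover have "exp \<beta> ^ card A * (1 - exp (- \<beta>)) ^ card A = (exp \<beta> - 1) ^ card A"
      by (simp add: power_mult_distrib[symmetric] right_diff_distrib exp_add[symmetric])
    ultimately show ?thesis
      by (simp add: k cluster_weight_def power_int_minus field_simps)
  qed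
  then show ?thesis
    by (simp add: potts_def swendsen_wang_def Let_def sum_distrib_left sum_divide_distrib)
qed

lemma swendsen_wang_nonneg: "0 \<le> SW \<sigma> \<tau>"
  using \<beta> unfolding swendsen_wang_def Let_def
  by (intro sum_nonneg mult_nonneg_nonneg zero_le_power zero_le_power_int) auto

text \<open>Summing over \<open>\<tau>\<close> first, the q^C(A) colourings compatible with
  \<open>A\<close> cancel the factor q^(-C(A)), and the binomial expansion of
  \<open>(p + (1 - p)) ^ card (mono \<sigma>)\<close> remains.\<close>

lemma swendsen_wang_row: "(\<Sum>\<tau>\<in>\<Omega>. SW \<sigma> \<tau>) = 1"
proof -
  let ?S = "mono \<sigma>"
  define p where "p = 1 - exp (- \<beta>)"
  define h where "h A = p ^ card A * (1 - p) ^ (card ?S - card A)" for A :: "'a set set"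
  have "SW \<sigma> \<tau> = (\<Sum>A\<in>Pow ?S. if A \<subseteq> mono \<tau> then h A / real q ^ num_components V A else 0)" for \<tau>
  proof -
    have "SW \<sigma> \<tau> = (\<Sum>A\<in>Pow (?S \<inter> mono \<tau>). h A / real q ^ num_components V A)"
      by (simp add: swendsen_wang_def Let_def h_def p_def power_int_minus divide_inverse)
    also have "\<dots> = (\<Sum>A\<in>Pow ?S. if A \<subseteq> mono \<tau> then h A / real q ^ num_components V A else 0)"
      using finite_mono by (intro sum.mono_neutral_cong_left) auto
    finally show ?thesis .
  qed
  then have "(\<Sum>\<tau>\<in>\<Omega>. SW \<sigma> \<tau>)
    = (\<Sum>A\<in>Pow ?S. \<Sum>\<tau>\<in>\<Omega>. if A \<subseteq> mono \<tau> then h A / real q ^ num_components V A else 0)"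
    by (simp add: sum.swap[of _ \<Omega>])
  also have "\<dots> = (\<Sum>A\<in>Pow ?S. real (card {\<tau>\<in>\<Omega>. A \<subseteq> mono \<tau>}) * (h A / real q ^ num_components V A))"
    using finite_configs by (simp add: sum.inter_filter[symmetric])
  also have "\<dots> = (\<Sum>A\<in>Pow ?S. h A)"
  proof (intro sum.cong refl)
    fix A assume "A \<in> Pow ?S"
    then have "A \<subseteq> E" using mono_edges_subset by blast
    then show "real (card {\<tau>\<in>\<Omega>. A \<subseteq> mono \<tau>}) * (h A / real q ^ num_components V A) = h A"
      using card_constant_on_components[OF finite_V edges] q by simp
  qed
  also have "\<dots> = 1" unfolding h_def sum_Pow_binomial[OF finite_mono] by simp
  finally show ?thesis .
qed

lemma swendsen_wang_reversible: "reversible_chain \<Omega> \<pi> SW"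
  unfolding reversible_chain_def
  using potts_pos sum_potts swendsen_wang_nonneg swendsen_wang_row
  by (auto intro: less_imp_le simp: potts_swendsen_wang Int_commute)

text \<open>Containment of \<open>A\<close> in both monochromatic sets factors into a condition on
  \<open>\<sigma>\<close> and the same condition on \<open>\<tau>\<close>, so the form is a
  nonnegative combination of squares, one for each \<open>A\<close>.\<close>

lemma swendsen_wang_psd: "0 \<le> (\<Sum>\<sigma>\<in>\<Omega>. \<Sum>\<tau>\<in>\<Omega>. \<pi> \<sigma> * SW \<sigma> \<tau> * f \<sigma> * f \<tau>)"
proof -
  define I where "I A \<sigma> = (if A \<subseteq> mono \<sigma> then f \<sigma> else 0)" for A \<sigma>
  have "\<pi> \<sigma> * SW \<sigma> \<tau> * f \<sigma> * f \<tau> = (\<Sum>A\<in>Pow E. cluster_weight A / Z * (I A \<sigma> * I A \<tau>))" for \<sigma> \<tau>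
  proof -
    have "\<pi> \<sigma> * SW \<sigma> \<tau> * f \<sigma> * f \<tau> =
      (\<Sum>A\<in>Pow (mono \<sigma> \<inter> mono \<tau>). cluster_weight A / Z * (f \<sigma> * f \<tau>))"
      unfolding potts_swendsen_wang by (simp only: sum_divide_distrib sum_distrib_right mult.assoc)
    also have "\<dots> = (\<Sum>A\<in>Pow E. cluster_weight A / Z * (I A \<sigma> * I A \<tau>))"
      using finite_E mono_edges_subset[of E]
      by (intro sum.mono_neutral_cong_left) (auto simp: I_def)
    finally show ?thesis .
  qed
  then have "(\<Sum>\<sigma>\<in>\<Omega>. \<Sum>\<tau>\<in>\<Omega>. \<pi> \<sigma> * SW \<sigma> \<tau> * f \<sigma> * f \<tau>)
    = (\<Sum>\<sigma>\<in>\<Omega>. \<Sum>\<tau>\<in>\<Omega>. \<Sum>A\<in>Pow E. cluster_weight A / Z * (I A \<sigma> * I A \<tau>))" by simp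
  also have "\<dots> = (\<Sum>\<sigma>\<in>\<Omega>. \<Sum>A\<in>Pow E. \<Sum>\<tau>\<in>\<Omega>. cluster_weight A / Z * (I A \<sigma> * I A \<tau>))"
    by (rule sum.cong[OF refl], rule sum.swap)
  also have "\<dots> = (\<Sum>A\<in>Pow E. \<Sum>\<sigma>\<in>\<Omega>. \<Sum>\<tau>\<in>\<Omega>. cluster_weight A / Z * (I A \<sigma> * I A \<tau>))"
    by (rule sum.swap)
  also have "\<dots> = (\<Sum>A\<in>Pow E. cluster_weight A / Z * (\<Sum>\<sigma>\<in>\<Omega>. I A \<sigma>)\<^sup>2)"
    by (simp only: power2_eq_square sum_product sum_distrib_left[symmetric])
  also have "\<dots> \<ge> 0"
    using cluster_weight_nonneg Z_pos by (intro sum_nonneg mult_nonneg_nonneg) auto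
  finally show ?thesis .
qed

section \<open>The heat-bath chain\<close>

text \<open>Agreement of \<open>\<sigma>\<close> and \<open>\<tau>\<close> off \<open>v\<close> is written \<open>\<tau> = \<sigma>(v := \<tau> v)\<close>.\<close>

lemma heat_bath_eq:
  assumes \<sigma>: "\<sigma> \<in> \<Omega>" and \<tau>: "\<tau> \<in> \<Omega>"
  shows "HB \<sigma> \<tau> = 1 / real (card V) *
    (\<Sum>v\<in>V. if \<tau> = \<sigma>(v := \<tau> v) then \<pi> \<tau> / (\<Sum>l\<in>{1..q}. \<pi> (\<sigma>(v := l))) else 0)"
proof -
  have "(\<Sum>k\<in>{1..q}. \<pi> (\<sigma>(v := k)) / (\<Sum>l\<in>{1..q}. \<pi> (\<sigma>(v := l))) * of_bool (\<tau> = \<sigma>(v := k)))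
    = (if \<tau> = \<sigma>(v := \<tau> v) then \<pi> \<tau> / (\<Sum>l\<in>{1..q}. \<pi> (\<sigma>(v := l))) else 0)" (is "?L = ?R") if v: "v \<in> V" for v
  proof -
    have "?L = (\<Sum>k\<in>{1..q}. if k = \<tau> v then ?R else 0)"
    proof (intro sum.cong refl)
      fix k
      have "\<tau> = \<sigma>(v := k) \<longleftrightarrow> k = \<tau> v \<and> \<tau> = \<sigma>(v := \<tau> v)" by (metis fun_upd_same)
      then show "\<pi> (\<sigma>(v := k)) / (\<Sum>l\<in>{1..q}. \<pi> (\<sigma>(v := l))) * of_bool (\<tau> = \<sigma>(v := k)) = (if k = \<tau> v then ?R else 0)"
        by (cases "\<tau> = \<sigma>(v := k)") auto
    qed
    then show ?thesis using color[OF \<tau> v] by simp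
  qed
  then show ?thesis unfolding heat_bath_def by simp
qed

lemma heat_bath_nonneg: "0 \<le> HB \<sigma> \<tau>"
  unfolding heat_bath_def using potts_pos
  by (intro mult_nonneg_nonneg sum_nonneg divide_nonneg_nonneg) (auto intro: less_imp_le)

lemma heat_bath_row:
  assumes "\<sigma> \<in> \<Omega>"
  shows "(\<Sum>\<tau>\<in>\<Omega>. HB \<sigma> \<tau>) = 1"
proof -
  define r where "r v k = \<pi> (\<sigma>(v := k)) / (\<Sum>l\<in>{1..q}. \<pi> (\<sigma>(v := l)))" for v k
  have row: "(\<Sum>k\<in>{1..q}. r v k) = 1" for v
  proof -
    have "(\<Sum>l\<in>{1..q}. \<pi> (\<sigma>(v := l))) > 0" using potts_pos q by (intro sum_pos) auto
    then show ?thesis by (simp add: r_def sum_divide_distrib[symmetric])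
  qed
  have "(\<Sum>\<tau>\<in>\<Omega>. HB \<sigma> \<tau>) =
    1 / real (card V) * (\<Sum>\<tau>\<in>\<Omega>. \<Sum>v\<in>V. \<Sum>k\<in>{1..q}. r v k * of_bool (\<tau> = \<sigma>(v := k)))"
    by (simp add: heat_bath_def r_def sum_distrib_left)
  also have "(\<Sum>\<tau>\<in>\<Omega>. \<Sum>v\<in>V. \<Sum>k\<in>{1..q}. r v k * of_bool (\<tau> = \<sigma>(v := k)))
    = (\<Sum>v\<in>V. \<Sum>\<tau>\<in>\<Omega>. \<Sum>k\<in>{1..q}. r v k * of_bool (\<tau> = \<sigma>(v := k)))"
    by (rule sum.swap)
  also have "\<dots> = (\<Sum>v\<in>V. \<Sum>k\<in>{1..q}. \<Sum>\<tau>\<in>\<Omega>. r v k * of_bool (\<tau> = \<sigma>(v := k)))"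
    by (rule sum.cong[OF refl], rule sum.swap)
  also have "\<dots> = (\<Sum>v\<in>V. \<Sum>k\<in>{1..q}. r v k)"
  proof (intro sum.cong refl)
    fix v k assume "v \<in> V" "k \<in> {1..q}"
    then have "\<sigma>(v := k) \<in> \<Omega>" by (rule fun_upd_configs[OF assms])
    moreover have "(\<Sum>\<tau>\<in>\<Omega>. r v k * of_bool (\<tau> = \<sigma>(v := k)))
      = (\<Sum>\<tau>\<in>\<Omega>. if \<tau> = \<sigma>(v := k) then r v k else 0)"
      by (intro sum.cong) auto
    ultimately show "(\<Sum>\<tau>\<in>\<Omega>. r v k * of_bool (\<tau> = \<sigma>(v := k))) = r v k"
      using finite_configs by simp
  qed
  also have "\<dots> = real (card V)" by (simp only: row) simp
  finally show ?thesis using finite_V V_nonempty by simp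
qed

text \<open>The normalising sum depends only on the colours off \<open>v\<close>, which
  \<open>\<sigma>\<close> and \<open>\<tau>\<close> share whenever a move at \<open>v\<close> links
  them; the numerator \<open>\<pi> \<sigma> * \<pi> \<tau>\<close> is symmetric.\<close>

lemma heat_bath_detailed_balance:
  assumes "\<sigma> \<in> \<Omega>" "\<tau> \<in> \<Omega>"
  shows "\<pi> \<sigma> * HB \<sigma> \<tau> = \<pi> \<tau> * HB \<tau> \<sigma>"
proof -
  have "\<pi> \<sigma> * (if \<tau> = \<sigma>(v := \<tau> v) then \<pi> \<tau> / (\<Sum>l\<in>{1..q}. \<pi> (\<sigma>(v := l))) else 0)
      = \<pi> \<tau> * (if \<sigma> = \<tau>(v := \<sigma> v) then \<pi> \<sigma> / (\<Sum>l\<in>{1..q}. \<pi> (\<tau>(v := l))) else 0)" for v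
  proof (cases "\<tau> = \<sigma>(v := \<tau> v)")
    case True
    then have "\<sigma> = \<tau>(v := \<sigma> v)" by (metis fun_upd_triv fun_upd_upd)
    moreover have "\<sigma>(v := l) = \<tau>(v := l)" for l using True by (metis fun_upd_upd)
    ultimately show ?thesis using True by simp
  next
    case False
    then have "\<sigma> \<noteq> \<tau>(v := \<sigma> v)" by (metis fun_upd_triv fun_upd_upd)
    then show ?thesis using False by simp
  qed
  then show ?thesis using assms by (simp add: heat_bath_eq sum_distrib_left)
qed

lemma heat_bath_reversible: "reversible_chain \<Omega> \<pi> HB"
  unfolding reversible_chain_def
  using potts_pos sum_potts heat_bath_nonneg heat_bath_row heat_bath_detailed_balance
  by (auto intro: less_imp_le)

lemma heat_bath_support:
  assumes "\<sigma> \<in> \<Omega>" "\<tau> \<in> \<Omega>" "HB \<sigma> \<tau> \<noteq> 0"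
  obtains v where "v \<in> V" "\<tau> = \<sigma>(v := \<tau> v)"
proof -
  have "\<exists>v\<in>V. \<tau> = \<sigma>(v := \<tau> v)"
  proof (rule ccontr)
    assume "\<not> ?thesis"
    then have "HB \<sigma> \<tau> = 0" using assms(1,2) by (auto simp: heat_bath_eq intro!: sum.neutral)
    with assms(3) show False by simp
  qed
  then show thesis using that by blast
qed

section \<open>Effect of recolouring single vertices\<close>

lemma degree_le: "v \<in> V \<Longrightarrow> card {e \<in> E. v \<in> e} \<le> \<Delta>"
  unfolding max_degree_def degree_in_def[symmetric] using finite_V by (intro Max_ge) auto

lemma mono_edges_fun_upd: "mono (\<sigma>(v := k)) \<subseteq> mono \<sigma> \<union> {e \<in> E. v \<in> e}"
  unfolding mono_edges_def by (auto split: if_splits)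

text \<open>Only the at most \<open>\<Delta>\<close> edges at \<open>v\<close> can become
  monochromatic, and each gains a factor \<open>exp \<beta>\<close>.\<close>

lemma potts_fun_upd_le:
  assumes "v \<in> V"
  shows "\<pi> (\<sigma>(v := k)) \<le> exp \<beta> ^ \<Delta> * \<pi> \<sigma>"
proof -
  have "card (mono (\<sigma>(v := k))) \<le> card (mono \<sigma> \<union> {e \<in> E. v \<in> e})"
    using finite_mono finite_E mono_edges_fun_upd by (intro card_mono) auto
  also have "\<dots> \<le> card (mono \<sigma>) + \<Delta>"
    using card_Un_le[of "mono \<sigma>" "{e \<in> E. v \<in> e}"] degree_le[OF assms] by linarith
  finally have "\<beta> * real (card (mono (\<sigma>(v := k)))) \<le> \<beta> * real (card (mono \<sigma>) + \<Delta>)"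
    using \<beta> by (intro mult_left_mono) auto
  also have "\<dots> = real \<Delta> * \<beta> + \<beta> * real (card (mono \<sigma>))" by (simp add: algebra_simps)
  finally have "exp (\<beta> * real (card (mono (\<sigma>(v := k))))) \<le> exp \<beta> ^ \<Delta> * exp (\<beta> * real (card (mono \<sigma>)))"
    by (simp add: exp_of_nat_mult[symmetric] exp_add[symmetric])
  then show ?thesis using Z_pos by (simp add: potts_def divide_right_mono)
qed

text \<open>The new edge contributes \<open>exp \<beta> - 1\<close>, and the loss of at most one
  component raises q^(-C(A)) by at most a factor \<open>q\<close>.\<close>

lemma cluster_weight_insert:
  assumes "A \<subseteq> E" "e \<in> E" "e \<notin> A"
  shows "cluster_weight (insert e A) \<le> real q * (exp \<beta> - 1) * cluster_weight A"
proof -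
  have "e \<subseteq> V" "card e = 2" using assms(2) edges by auto
  then obtain u v where e: "e = {u, v}" and u: "u \<in> V" by (auto simp: card_2_iff)
  have fA: "finite A" using assms(1) finite_E by (rule finite_subset)
  have "real q ^ num_components V A \<le> real q ^ Suc (num_components V (insert e A))"
    using num_components_insert[OF finite_V u, of A v] q unfolding e by (intro power_increasing) auto
  then have "1 / real q ^ num_components V (insert e A) \<le> real q / real q ^ num_components V A"
    using q by (simp add: field_simps)
  then have "(exp \<beta> - 1) ^ Suc (card A) * (1 / real q ^ num_components V (insert e A))
    \<le> (exp \<beta> - 1) ^ Suc (card A) * (real q / real q ^ num_components V A)"
    using \<beta> by (intro mult_left_mono) auto
  then show ?thesis using fA assms(3) by (simp add: cluster_weight_def mult_ac)
qed

lemma swendsen_wang_fun_upd_le: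
  assumes v: "v \<in> V" and w: "w \<in> V"
  shows "\<pi> (\<sigma>(v := k)) * SW (\<sigma>(v := k)) (\<tau>(w := l)) \<le> (real q * exp \<beta>) ^ (2 * \<Delta>) * (\<pi> \<sigma> * SW \<sigma> \<tau>)"
proof -
  define T where "T = mono \<sigma> \<inter> mono \<tau>"
  \<comment> \<open>Every edge that recolouring adds to the common monochromatic set lies at
    \<open>v\<close> or at \<open>w\<close>, so enlarging \<open>T\<close> by \<open>F\<close>
    covers the recoloured pair.\<close>
  define F where "F = {e \<in> E. v \<in> e} \<union> {e \<in> E. w \<in> e}"
  let ?y = "real q * (exp \<beta> - 1)"
  have TF: "T \<subseteq> E" "F \<subseteq> E" "finite T" "finite F"
    using mono_edges_subset finite_E finite_mono by (auto simp: T_def F_def)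
  \<comment> \<open>Since \<open>1 + ?y\<close> equals
    \<open>real q * exp \<beta> - (real q - 1)\<close>, the growth per edge of \<open>F\<close> is
    at most \<open>real q * exp \<beta>\<close>.\<close>
  have y: "0 \<le> ?y" "1 + ?y \<le> real q * exp \<beta>" using \<beta> q by (auto simp: right_diff_distrib)
  have nn: "0 \<le> (\<Sum>A\<in>Pow T. cluster_weight A)" by (intro sum_nonneg cluster_weight_nonneg)
  have cF: "card F \<le> 2 * \<Delta>"
    using card_Un_le[of "{e \<in> E. v \<in> e}" "{e \<in> E. w \<in> e}"] degree_le[OF v] degree_le[OF w]
    unfolding F_def by linarith
  have "mono (\<sigma>(v := k)) \<inter> mono (\<tau>(w := l)) \<subseteq> T \<union> F"
    using mono_edges_fun_upd[of \<sigma> v k] mono_edges_fun_upd[of \<tau> w l] unfolding T_def F_def by blast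
  then have "(\<Sum>A\<in>Pow (mono (\<sigma>(v := k)) \<inter> mono (\<tau>(w := l))). cluster_weight A)
    \<le> (\<Sum>A\<in>Pow (T \<union> F). cluster_weight A)"
    using TF cluster_weight_nonneg by (intro sum_mono2) auto
  also have "\<dots> \<le> (1 + ?y) ^ card F * (\<Sum>A\<in>Pow T. cluster_weight A)"
    using TF y(1) cluster_weight_nonneg by (intro sum_Pow_union_le cluster_weight_insert) auto
  also have "(1 + ?y) ^ card F \<le> (1 + ?y) ^ (2 * \<Delta>)" using y(1) cF by (intro power_increasing) auto
  also have "\<dots> \<le> (real q * exp \<beta>) ^ (2 * \<Delta>)" using y by (intro power_mono) auto
  finally show ?thesis
    unfolding potts_swendsen_wang T_def[symmetric] using nn Z_pos
    by (simp add: divide_right_mono mult_right_mono)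
qed

text \<open>Here \<open>HB\<close> is summed down its columns, which need not sum to one. Reversing
  the two moves costs a factor \<open>exp \<beta> ^ \<Delta>\<close> each and leaves row sums, which
  are one.\<close>

lemma heat_bath_conjugate_le:
  assumes \<sigma>: "\<sigma> \<in> \<Omega>" and \<tau>: "\<tau> \<in> \<Omega>"
  shows "(\<Sum>\<sigma>'\<in>\<Omega>. \<Sum>\<tau>'\<in>\<Omega>. \<pi> \<sigma>' * SW \<sigma>' \<tau>' * HB \<sigma>' \<sigma> * HB \<tau>' \<tau>)
    \<le> (real q * exp (2 * \<beta>)) ^ (2 * \<Delta>) * (\<pi> \<sigma> * SW \<sigma> \<tau>)"
proof -
  let ?c = "(real q * exp (2 * \<beta>)) ^ (2 * \<Delta>)"
  \<comment> \<open>The first factor comes from recolouring in the Swendsen-Wang flow, the two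
    factors \<open>exp \<beta> ^ \<Delta>\<close> from reversing the heat-bath moves.\<close>
  have c: "?c = (real q * exp \<beta>) ^ (2 * \<Delta>) * (exp \<beta> ^ \<Delta> * exp \<beta> ^ \<Delta>)"
  proof -
    have "exp (2 * \<beta>) = exp \<beta> * exp \<beta>" by (simp add: exp_add[symmetric])
    then show ?thesis by (simp add: power_mult_distrib power_mult power2_eq_square mult_ac)
  qed
  \<comment> \<open>By detailed balance the reversal costs the ratio
    \<open>\<pi> \<rho> / \<pi> \<rho>'\<close>, and a possible move changes at most one
    vertex.\<close>
  have rev: "HB \<rho>' \<rho> \<le> exp \<beta> ^ \<Delta> * HB \<rho> \<rho>'" if \<rho>: "\<rho> \<in> \<Omega>" and \<rho>': "\<rho>' \<in> \<Omega>" for \<rho> \<rho>'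
  proof (cases "HB \<rho>' \<rho> = 0")
    case True
    then show ?thesis using heat_bath_nonneg by simp
  next
    case False
    then obtain v where v: "v \<in> V" "\<rho> = \<rho>'(v := \<rho> v)" using heat_bath_support[OF \<rho>' \<rho>] by blast
    have "\<pi> \<rho> \<le> exp \<beta> ^ \<Delta> * \<pi> \<rho>'" using potts_fun_upd_le[OF v(1), of \<rho>' "\<rho> v"] unfolding v(2)[symmetric] .
    then have "\<pi> \<rho> * HB \<rho> \<rho>' \<le> exp \<beta> ^ \<Delta> * \<pi> \<rho>' * HB \<rho> \<rho>'"
      using heat_bath_nonneg by (intro mult_right_mono)
    then have "\<pi> \<rho>' * HB \<rho>' \<rho> \<le> \<pi> \<rho>' * (exp \<beta> ^ \<Delta> * HB \<rho> \<rho>')"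
      using heat_bath_detailed_balance[OF \<rho> \<rho>'] by (simp add: mult_ac)
    then show ?thesis using potts_pos[of \<rho>'] by (simp only: mult_le_cancel_left_pos)
  qed
  have "\<pi> \<sigma>' * SW \<sigma>' \<tau>' * HB \<sigma>' \<sigma> * HB \<tau>' \<tau> \<le> ?c * (\<pi> \<sigma> * SW \<sigma> \<tau>) * (HB \<sigma> \<sigma>' * HB \<tau> \<tau>')"
    if \<sigma>': "\<sigma>' \<in> \<Omega>" and \<tau>': "\<tau>' \<in> \<Omega>" for \<sigma>' \<tau>'
  \<comment> \<open>If a forward move is impossible, so is its reversal, and both sides vanish;
    otherwise \<open>\<sigma>'\<close> and \<open>\<tau>'\<close> each arise by recolouring one
    vertex.\<close>
  proof (cases "HB \<sigma> \<sigma>' = 0 \<or> HB \<tau> \<tau>' = 0")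
    case True
    then have "HB \<sigma>' \<sigma> = 0 \<or> HB \<tau>' \<tau> = 0"
      using heat_bath_detailed_balance[OF \<sigma> \<sigma>'] heat_bath_detailed_balance[OF \<tau> \<tau>']
        potts_pos[of \<sigma>'] potts_pos[of \<tau>'] by auto
    then show ?thesis using True by auto
  next
    case False
    obtain v where v: "v \<in> V" "\<sigma>' = \<sigma>(v := \<sigma>' v)"
      using heat_bath_support[OF \<sigma> \<sigma>'] False by blast
    obtain w where w: "w \<in> V" "\<tau>' = \<tau>(w := \<tau>' w)"
      using heat_bath_support[OF \<tau> \<tau>'] False by blast
    have "\<pi> \<sigma>' * SW \<sigma>' \<tau>' \<le> (real q * exp \<beta>) ^ (2 * \<Delta>) * (\<pi> \<sigma> * SW \<sigma> \<tau>)"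
      using swendsen_wang_fun_upd_le[OF v(1) w(1), of \<sigma> "\<sigma>' v" \<tau> "\<tau>' w"]
      unfolding v(2)[symmetric] w(2)[symmetric] .
    moreover have "HB \<sigma>' \<sigma> * HB \<tau>' \<tau> \<le> (exp \<beta> ^ \<Delta> * HB \<sigma> \<sigma>') * (exp \<beta> ^ \<Delta> * HB \<tau> \<tau>')"
      using rev \<sigma> \<tau> \<sigma>' \<tau>' heat_bath_nonneg by (intro mult_mono) auto
    ultimately have "\<pi> \<sigma>' * SW \<sigma>' \<tau>' * (HB \<sigma>' \<sigma> * HB \<tau>' \<tau>)
      \<le> (real q * exp \<beta>) ^ (2 * \<Delta>) * (\<pi> \<sigma> * SW \<sigma> \<tau>) * ((exp \<beta> ^ \<Delta> * HB \<sigma> \<sigma>') * (exp \<beta> ^ \<Delta> * HB \<tau> \<tau>'))"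
      by (rule mult_mono) (simp_all add: heat_bath_nonneg swendsen_wang_nonneg potts_nonneg)
    then show ?thesis unfolding c by (simp add: mult_ac)
  qed
  then have "(\<Sum>\<sigma>'\<in>\<Omega>. \<Sum>\<tau>'\<in>\<Omega>. \<pi> \<sigma>' * SW \<sigma>' \<tau>' * HB \<sigma>' \<sigma> * HB \<tau>' \<tau>)
    \<le> (\<Sum>\<sigma>'\<in>\<Omega>. \<Sum>\<tau>'\<in>\<Omega>. ?c * (\<pi> \<sigma> * SW \<sigma> \<tau>) * (HB \<sigma> \<sigma>' * HB \<tau> \<tau>'))"
    by (intro sum_mono)
  also have "\<dots> = ?c * (\<pi> \<sigma> * SW \<sigma> \<tau>) * ((\<Sum>\<sigma>'\<in>\<Omega>. HB \<sigma> \<sigma>') * (\<Sum>\<tau>'\<in>\<Omega>. HB \<tau> \<tau>'))"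
    by (simp only: sum_product sum_distrib_left[symmetric])
  finally show ?thesis using heat_bath_row \<sigma> \<tau> by simp
qed

section \<open>Comparison of the two gaps\<close>

lemma finite_reversible_swendsen_wang: "finite_reversible \<Omega> \<pi> SW"
  and finite_reversible_heat_bath: "finite_reversible \<Omega> \<pi> HB"
  by (unfold_locales; rule finite_configs card_configs swendsen_wang_reversible
      heat_bath_reversible potts_pos)+

theorem swendsen_wang_gap: "c_SW V E \<beta> q * spectral_gap \<Omega> HB \<le> spectral_gap \<Omega> SW"
proof -
  let ?b = "real q * exp (2 * \<beta>)"
  interpret SW: finite_reversible \<Omega> \<pi> SW by (rule finite_reversible_swendsen_wang)
  have "1 * 1 \<le> real q * exp (2 * \<beta>)" using q \<beta> by (intro mult_mono) auto
  then have b: "1 \<le> ?b" by simp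
  have cSW: "c_SW V E \<beta> q = 1 / (2 * (real q)\<^sup>2 * ?b ^ (4 * \<Delta>))"
  proof -
    have "?b powi (- 4 * int \<Delta>) = ?b powi (- int (4 * \<Delta>))" by simp
    also have "\<dots> = inverse (?b ^ (4 * \<Delta>))" by (simp only: power_int_minus power_int_of_nat)
    finally show ?thesis
      by (simp only: c_SW_def divide_inverse inverse_mult_distrib mult_1_left)
  qed
  \<comment> \<open>The comparison costs only \<open>?b ^ (2 * \<Delta>)\<close>. As
    \<open>?b\<close> and \<open>2 * (real q)\<^sup>2\<close> are at least 1, \<open>c_SW\<close>
    absorbs this factor, and nonnegativity of the Swendsen-Wang gap allows the product to be
    replaced by 1.\<close>
  have le: "c_SW V E \<beta> q * ?b ^ (2 * \<Delta>) \<le> 1"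
  proof -
    have "1 * 1 \<le> real q * real q" using q by (intro mult_mono) auto
    then have "1 * ?b ^ (2 * \<Delta>) \<le> 2 * (real q)\<^sup>2 * ?b ^ (4 * \<Delta>)"
      using b by (intro mult_mono power_increasing) (auto simp: power2_eq_square)
    moreover have "0 < 2 * (real q)\<^sup>2 * ?b ^ (4 * \<Delta>)" using q by simp
    ultimately show ?thesis unfolding cSW by (simp add: field_simps)
  qed
  have "spectral_gap \<Omega> HB \<le> ?b ^ (2 * \<Delta>) * spectral_gap \<Omega> SW"
    by (rule spectral_gap_comparison[OF finite_reversible_swendsen_wang finite_reversible_heat_bath
          swendsen_wang_psd heat_bath_conjugate_le])
  then have "c_SW V E \<beta> q * spectral_gap \<Omega> HB \<le> (c_SW V E \<beta> q * ?b ^ (2 * \<Delta>)) * spectral_gap \<Omega> SW"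
    unfolding mult.assoc by (intro mult_left_mono) (simp_all add: cSW)
  also have "\<dots> \<le> 1 * spectral_gap \<Omega> SW"
    using le SW.spectral_gap_bounds(1) by (rule mult_right_mono)
  finally show ?thesis by simp
qed

end

theorem theorem1:
  fixes V :: "'a set" and E :: "'a set set" and q :: nat and \<beta> :: real
  assumes "simple_graph V E" and "q \<ge> 2" and "\<beta> \<ge> 0"
  shows "reversible_chain (configs V q) (potts V E \<beta> q) (swendsen_wang V E \<beta> q) \<and>
         reversible_chain (configs V q) (potts V E \<beta> q) (heat_bath V E \<beta> q) \<and>
         spectral_gap (configs V q) (swendsen_wang V E \<beta> q)
           \<ge> c_SW V E \<beta> q * spectral_gap (configs V q) (heat_bath V E \<beta> q)"
proof -
  interpret potts_model V E q \<beta> using assms by unfold_locales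
  show ?thesis using swendsen_wang_reversible heat_bath_reversible swendsen_wang_gap by simp
qed

end
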